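(* Suppose that a Banach space $Z$ admits a coarse embedding or a uniform embedding into a Hilbert space. Then a subset $X\subseteq Z$ (with the induced metric) has Markov type 2 if and only if $X$ threshold-embeds into a Hilbert space.
   Context: A uniform embedding is an invertible map $f$ such that $f$ and $f^{-1}$ are uniformly continuous. A map $f:X\to L_2$ is a coarse embedding if there are non-decreasing $\alpha,\beta:[0,\infty)\to[0,\infty)$ with $\beta(t)\to\infty$ as $t\to\infty$ and $\beta(d(x,y))\le\|f(x)-f(y)\|_2\le\alpha(d(x,y))$ for all $x,y$. Markov type: $(X,d)$ has Markov type $p$ if there is $M>0$ such that for every $n$, every stationary reversible Markov chain $\{Z_t\}$ on $\{1,\dots,n\}$ (with $Z_0$ stationary), every $f:\{1,\dots,n\}\to X$ and every $t\in\mathbb N$, $\mathbb E\, d(f(Z_t),f(Z_0))^p\le M^p t\,\mathbb E\, d(f(Z_0),f(Z_1))^p$. Threshold embedding: $(X,d_X)$ $K$-threshold-embeds into $(Y,d_Y)$ if there is a family of Lipschitz maps $\{\varphi_\tau\}_{\tau>0}$ with $d_X(x,y)\ge\tau\Rightarrow d_Y(\varphi_\tau(x),\varphi_\tau(y))\ge\|\varphi_\tau\|_{\mathrm{Lip}}\tau/K$; $X$ threshold-embeds if this holds for some $K$.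
   Formalization: Threshold maps are taken 1-Lipschitz with separation at least τ/K, since with ‖φ_τ‖_Lip τ/K constant maps always qualify and the claim fails (e.g. for ℓ_1); the Hilbert space is fixed as ℓ_2(Z), into which the closed span of any image of X embeds isometrically. *)

theory Defs
  imports "HOL-Analysis.Analysis"
begin

text \<open>A stationary reversible Markov chain on the state space {0..<n}
 (standing for {1..n}): stationary distribution w, transition matrix P.\<close>
definition rev_markov_chain :: "nat \<Rightarrow> (nat \<Rightarrow> real) \<Rightarrow> (nat \<Rightarrow> nat \<Rightarrow> real) \<Rightarrow> bool" where
  "rev_markov_chain n w P \<longleftrightarrow>
     (\<forall>i<n. w i \<ge> 0) \<and> (\<Sum>i<n. w i) = 1 \<and>
     (\<forall>i<n. \<forall>j<n. P i j \<ge> 0) \<and> (\<forall>i<n. (\<Sum>j<n. P i j) = 1) \<and>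
     (\<forall>j<n. (\<Sum>i<n. w i * P i j) = w j) \<and>
     (\<forall>i<n. \<forall>j<n. w i * P i j = w j * P j i)"

fun mat_pow :: "nat \<Rightarrow> (nat \<Rightarrow> nat \<Rightarrow> real) \<Rightarrow> nat \<Rightarrow> nat \<Rightarrow> nat \<Rightarrow> real" where
  "mat_pow n P 0 = (\<lambda>i j. if i = j then 1 else 0)"
| "mat_pow n P (Suc t) = (\<lambda>i j. \<Sum>k<n. mat_pow n P t i k * P k j)"

text \<open>Markov type p of a subset X of a metric space (induced metric).
 E d(f(Z_t),f(Z_0))^p = sum_{i,j} pi_i (P^t)_{ij} d(f i, f j)^p.\<close>
definition markov_type :: "real \<Rightarrow> 'a::metric_space set \<Rightarrow> bool" where
  "markov_type p X \<longleftrightarrow> (\<exists>M>0. \<forall>n w P (f::nat \<Rightarrow> 'a) (t::nat).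
     rev_markov_chain n w P \<and> (\<forall>i<n. f i \<in> X) \<longrightarrow>
       (\<Sum>i<n. \<Sum>j<n. w i * mat_pow n P t i j * dist (f i) (f j) powr p)
         \<le> M powr p * real t * (\<Sum>i<n. \<Sum>j<n. w i * P i j * dist (f i) (f j) powr p))"

definition uniform_embedding :: "('a::metric_space \<Rightarrow> 'b::metric_space) \<Rightarrow> bool" where
  "uniform_embedding f \<longleftrightarrow> inj f \<and> uniformly_continuous_on UNIV f \<and>
     uniformly_continuous_on (range f) (inv f)"

definition coarse_embedding :: "('a::metric_space \<Rightarrow> 'b::metric_space) \<Rightarrow> bool" where
  "coarse_embedding f \<longleftrightarrow> (\<exists>\<alpha> \<beta> :: real \<Rightarrow> real.
     mono_on {0..} \<alpha> \<and> mono_on {0..} \<beta> \<and> (\<forall>t\<ge>0. \<alpha> t \<ge> 0 \<and> \<beta> t \<ge> 0) \<and>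
     filterlim \<beta> at_top at_top \<and>
     (\<forall>x y. \<beta> (dist x y) \<le> dist (f x) (f y) \<and> dist (f x) (f y) \<le> \<alpha> (dist x y)))"

definition l2_space :: "('i \<Rightarrow> real) set" where
  "l2_space = {f. (\<lambda>i. (f i)\<^sup>2) summable_on UNIV}"

definition l2_dist :: "('i \<Rightarrow> real) \<Rightarrow> ('i \<Rightarrow> real) \<Rightarrow> real" where
  "l2_dist f g = sqrt (\<Sum>\<^sub>\<infinity>i. (f i - g i)\<^sup>2)"

text \<open>Threshold embedding (Ding-Lee-Peres normalisation: 1-Lipschitz maps)
 of X into the Hilbert space l2(I), where I is the type of the points of X.\<close>
definition threshold_embeds_l2 :: "'a::metric_space set \<Rightarrow> bool" where
  "threshold_embeds_l2 X \<longleftrightarrow> (\<exists>K>0. \<forall>\<tau>>0. \<exists>\<phi> :: 'a \<Rightarrow> ('a \<Rightarrow> real).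
     (\<forall>x\<in>X. \<phi> x \<in> l2_space) \<and>
     (\<forall>x\<in>X. \<forall>y\<in>X. l2_dist (\<phi> x) (\<phi> y) \<le> dist x y) \<and>
     (\<forall>x\<in>X. \<forall>y\<in>X. dist x y \<ge> \<tau> \<longrightarrow> l2_dist (\<phi> x) (\<phi> y) \<ge> \<tau> / K))"

end

theory Submission
  imports Defs
begin

text \<open>
  From Markov type 2 to threshold maps. Rescaling the given embedding yields, at each scale, a map
  \<open>g\<close> into a Hilbert space that is Lipschitz at large distances and separates points at distance
  \<open>\<tau>\<close> by a large multiple of its modulus \<open>\<omega>\<close>. On finitely many points, \<open>g\<close> is within \<open>3 \<omega>\<close> of a
  genuinely Lipschitz map: by convex duality only weighted averages of the constraints matter, and
  for given weights the Cesaro means of \<open>g\<close> along an associated reversible chain do the job,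
  Markov type 2 controlling how far the chain travels (Ball's extension argument). The Gram kernels
  of these finite approximations converge by Tychonoff's theorem, and a transfinite Cholesky
  factorisation realises the limit kernel in \<open>l2\<close>.

  From threshold maps to Markov type 2. At scale \<open>2\<^sup>k\<close> the displacement of the image of the chain is
  half the difference of a forward and a backward martingale. Stopping the martingales when the
  quadratic variation \<open>V\<close> of the chain in the original metric exceeds \<open>4\<^sup>k\<close> and using fourth moments, the
  \<open>k\<close>-th contribution is at most a multiple of \<open>min (4\<^sup>k, V\<^sup>2 / 4\<^sup>k)\<close>. As \<open>V\<close> does not depend on
  \<open>k\<close>, these bounds sum to a multiple of \<open>V\<close>.
\<close>

text \<open>Markov type 2 speaks of averages over a chain, whereas a threshold map must obey a
  constraint at every pair of points. Duality bridges the two for finitely many constraints, so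
  finite subsets come first and a limit afterwards. The limit is taken in the Gram kernels and not
  in the maps, since the approximations need not converge in the given Hilbert space and the target
  is \<open>l2\<close> indexed by the points. The linear structure of \<open>Z\<close> enters twice:
  segments turn a modulus at one small scale into a Lipschitz bound at large distances, and
  dilations let one gap of the embedding serve every \<open>\<tau>\<close>.

  In the converse, using Markov type 2 of Hilbert space at each scale separately would cost the full
  energy each time, and the total would grow with the number of scales. Second moments at scale
  \<open>s\<close> give about \<open>min (s^2) V\<close>, which does not decay for
  \<open>s^2\<close> above \<open>V\<close>; fourth moments give decay on both sides of
  \<open>s^2 = V\<close>. Stopping makes them affordable although only the first moment of
  \<open>V\<close> is controlled.\<close>

section \<open>A minimax alternative\<close>

text \<open>A Lagrange multiplier for one constraint. Points with \<open>h < 0\<close> bound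
  \<open>c\<close> above by \<open>G x / (- h x)\<close>, points with \<open>h > 0\<close> and
  \<open>G < 0\<close> bound it below by \<open>- G y / h y\<close>, and \<open>cross\<close> says
  that these bounds are compatible. The Slater point \<open>x0\<close> makes the infimum range over
  a nonempty set and rules out \<open>h y = 0\<close> with \<open>G y < 0\<close>.\<close>

lemma convexlike_pair_multiplier:
  fixes G h :: "'c \<Rightarrow> real"
  assumes cvx: "\<And>x y t. x \<in> C \<Longrightarrow> y \<in> C \<Longrightarrow> 0 \<le> t \<Longrightarrow> t \<le> 1 \<Longrightarrow>
      \<exists>z\<in>C. G z \<le> (1 - t) * G x + t * G y \<and> h z \<le> (1 - t) * h x + t * h y"
    and x0: "x0 \<in> C" "h x0 < 0"
    and nonneg: "\<And>x. x \<in> C \<Longrightarrow> h x < 0 \<Longrightarrow> 0 \<le> G x"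
  shows "\<exists>c\<ge>0. \<forall>x\<in>C. 0 \<le> G x + c * h x"
proof -
  let ?N = "{x\<in>C. h x < 0}"
  let ?R = "(\<lambda>x. G x / (- h x)) ` ?N"
  define c where "c = Inf ?R"
  have ne: "?R \<noteq> {}" using x0 by blast
  have lb: "0 \<le> r" if "r \<in> ?R" for r
    using that nonneg by (force simp: divide_nonneg_neg)
  have bdd: "bdd_below ?R" using lb by (meson bdd_belowI)
  have c0: "c \<ge> 0" unfolding c_def using ne lb by (rule cInf_greatest)
  have cross: "G y * h x \<le> G x * h y" if xy: "x \<in> C" "h x < 0" "y \<in> C" "h y \<ge> 0" "G y < 0" for x y
  proof (rule ccontr)
    assume "\<not> ?thesis"
    then have lt: "G x * h y < G y * h x" by simp
    have Gx: "0 \<le> G x" using nonneg xy by blast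
    \<comment> \<open>On the segment from \<open>x\<close> to \<open>y\<close> the interpolated
      \<open>G\<close> is negative after \<open>a\<close>, and the interpolated \<open>h\<close> is
      negative before \<open>b\<close>. The failing inequality says \<open>a < b\<close>, so a
      parameter in between makes both negative.\<close>
    define a where "a = G x / (G x - G y)"
    define b where "b = - h x / (h y - h x)"
    define t where "t = (a + b) / 2"
    have pos: "G x - G y > 0" "h y - h x > 0" using Gx xy by auto
    have ab: "a < b" using pos lt unfolding a_def b_def
      by (simp add: divide_simps algebra_simps)
    have a0: "0 \<le> a" "b \<le> 1" using pos Gx xy unfolding a_def b_def by (auto simp: divide_simps)
    have t: "a < t" "t < b" using ab unfolding t_def by auto
    obtain z where z: "z \<in> C" "G z \<le> (1 - t) * G x + t * G y" "h z \<le> (1 - t) * h x + t * h y"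
      using cvx[of x y t] xy t a0 by auto
    have "a * (G x - G y) < t * (G x - G y)" using t pos by (intro mult_strict_right_mono) auto
    moreover have "a * (G x - G y) = G x" using pos by (simp add: a_def)
    ultimately have "G z < 0" using z(2) by (simp add: algebra_simps)
    have "t * (h y - h x) < b * (h y - h x)" using t pos by (intro mult_strict_right_mono) auto
    moreover have "b * (h y - h x) = - h x" using pos by (simp add: b_def)
    ultimately have "h z < 0" using z(3) by (simp add: algebra_simps)
    show False using nonneg \<open>G z < 0\<close> \<open>h z < 0\<close> z(1) by force
  qed
  have "0 \<le> G y + c * h y" if y: "y \<in> C" for y
  proof -
    consider "h y < 0" | "h y \<ge> 0" "G y \<ge> 0" | "h y = 0" "G y < 0" | "h y > 0" "G y < 0" by linarith
    then show ?thesis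
    proof cases
      case 1
      then have "c \<le> G y / (- h y)" unfolding c_def using y bdd by (intro cInf_lower) auto
      then show ?thesis using 1 by (simp add: divide_simps)
    next
      case 2 then show ?thesis using c0 by simp
    next
      case 3
      then have "G y * h x0 \<le> 0" using cross[OF x0 y] by simp
      moreover have "G y * h x0 > 0" using 3 x0 by (simp add: mult_neg_neg)
      ultimately show ?thesis by simp
    next
      case 4
      have "- G y / h y \<le> c" unfolding c_def
      proof (rule cInf_greatest[OF ne])
        fix r assume "r \<in> ?R"
        then obtain x where x: "x \<in> C" "h x < 0" "r = G x / (- h x)" by auto
        have "G y * h x \<le> G x * h y" using cross x y 4 by simp
        then show "- G y / h y \<le> r" unfolding x(3) using x(2) 4
          by (simp add: divide_le_eq le_divide_eq mult.commute minus_divide_left[symmetric] le_minus_iff neg_le_divide_eq neg_divide_le_eq)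
      qed
      then show ?thesis using 4 by (simp add: divide_simps)
    qed
  qed
  then show ?thesis using c0 by blast
qed

text \<open>Fan's alternative for convexlike functions, replacing a separation theorem in a space
  whose dimension would depend on the index set.\<close>

lemma convexlike_alternative:
  fixes g :: "'i \<Rightarrow> 'c \<Rightarrow> real"
  assumes "finite I" "C \<noteq> {}"
    and "\<And>x y t. x \<in> C \<Longrightarrow> y \<in> C \<Longrightarrow> 0 \<le> t \<Longrightarrow> t \<le> 1 \<Longrightarrow>
      \<exists>z\<in>C. \<forall>i\<in>I. g i z \<le> (1 - t) * g i x + t * g i y"
    and "\<And>x. x \<in> C \<Longrightarrow> \<exists>i\<in>I. 0 \<le> g i x"
  shows "\<exists>\<nu>. (\<forall>i\<in>I. 0 \<le> \<nu> i) \<and> (\<Sum>i\<in>I. \<nu> i) = (1::real) \<and> (\<forall>x\<in>C. 0 \<le> (\<Sum>i\<in>I. \<nu> i * g i x))"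
  using assms
proof (induction I arbitrary: C rule: finite_induct)
  case empty
  then show ?case by blast
next
  case (insert a I)
  \<comment> \<open>Where \<open>g a\<close> is negative some other \<open>g i\<close> must be
    nonnegative, so the induction hypothesis applies to \<open>?C\<close>. Its weights merge the
    other functions into one function \<open>G\<close>, and the multiplier lemma brings
    \<open>a\<close> back.\<close>
  let ?C = "{x\<in>C. g a x < 0}"
  show ?case
  proof (cases "?C = {}")
    case True
    define \<nu> where "\<nu> i = (if i = a then 1 else 0 :: real)" for i
    have "(\<Sum>i\<in>I. \<nu> i * g i x) = 0" for x
      using insert.hyps by (intro sum.neutral) (auto simp: \<nu>_def)
    moreover have "(\<Sum>i\<in>I. \<nu> i) = 0" using insert.hyps by (intro sum.neutral) (auto simp: \<nu>_def)
    ultimately show ?thesis using True insert.hyps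
      by (intro exI[of _ \<nu>]) (auto simp: \<nu>_def not_less)
  next
    case False
    have "\<exists>\<nu>. (\<forall>i\<in>I. 0 \<le> \<nu> i) \<and> (\<Sum>i\<in>I. \<nu> i) = (1::real) \<and> (\<forall>x\<in>?C. 0 \<le> (\<Sum>i\<in>I. \<nu> i * g i x))"
    proof (rule insert.IH[OF False])
      fix x y and t :: real assume xy: "x \<in> ?C" "y \<in> ?C" and t: "0 \<le> t" "t \<le> 1"
      obtain z where z: "z \<in> C" "\<forall>i\<in>insert a I. g i z \<le> (1 - t) * g i x + t * g i y"
        using insert.prems(2)[of x y t] xy t by blast
      have "(1 - t) * g a x + t * g a y < 0"
        using xy t by (intro convex_bound_lt) auto
      then show "\<exists>z\<in>?C. \<forall>i\<in>I. g i z \<le> (1 - t) * g i x + t * g i y" using z by force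
    next
      fix x assume "x \<in> ?C"
      then show "\<exists>i\<in>I. 0 \<le> g i x" using insert.prems(3)[of x] by auto
    qed
    then obtain \<nu> where \<nu>: "\<forall>i\<in>I. 0 \<le> \<nu> i" "(\<Sum>i\<in>I. \<nu> i) = (1::real)"
      "\<forall>x\<in>?C. 0 \<le> (\<Sum>i\<in>I. \<nu> i * g i x)" by blast
    define G where "G x = (\<Sum>i\<in>I. \<nu> i * g i x)" for x
    obtain x0 where x0: "x0 \<in> C" "g a x0 < 0" using False by blast
    have "\<exists>c\<ge>0. \<forall>x\<in>C. 0 \<le> G x + c * g a x"
    proof (rule convexlike_pair_multiplier[where ?x0.0 = x0])
      fix x y and t :: real assume xy: "x \<in> C" "y \<in> C" and t: "0 \<le> t" "t \<le> 1"
      obtain z where z: "z \<in> C" "\<forall>i\<in>insert a I. g i z \<le> (1 - t) * g i x + t * g i y"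
        using insert.prems(2)[of x y t] xy t by blast
      have "G z \<le> (\<Sum>i\<in>I. \<nu> i * ((1 - t) * g i x + t * g i y))"
        unfolding G_def using \<nu> z by (intro sum_mono mult_left_mono) auto
      also have "\<dots> = (1 - t) * G x + t * G y"
        by (simp add: G_def sum_distrib_left algebra_simps sum.distrib sum_subtractf)
      finally show "\<exists>z\<in>C. G z \<le> (1 - t) * G x + t * G y \<and> g a z \<le> (1 - t) * g a x + t * g a y"
        using z by blast
    qed (use \<nu> x0 in \<open>auto simp: G_def\<close>)
    then obtain c where c: "c \<ge> 0" "\<forall>x\<in>C. 0 \<le> G x + c * g a x" by blast
    define \<mu> where "\<mu> i = (if i = a then c else \<nu> i) / (1 + c)" for i
    have \<mu>I: "\<mu> i = \<nu> i / (1 + c)" if "i \<in> I" for i using that insert.hyps by (auto simp: \<mu>_def)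
    have "(\<Sum>i\<in>insert a I. \<mu> i) = c / (1 + c) + (\<Sum>i\<in>I. \<nu> i) / (1 + c)"
      using insert.hyps by (simp add: \<mu>I sum_divide_distrib) (simp add: \<mu>_def)
    then have "(\<Sum>i\<in>insert a I. \<mu> i) = 1"
      using \<nu>(2) c(1) by (simp add: add_divide_distrib[symmetric] add.commute)
    moreover have "(\<Sum>i\<in>insert a I. \<mu> i * g i x) = (G x + c * g a x) / (1 + c)" for x
      using insert.hyps unfolding G_def
      by (simp add: \<mu>I sum_divide_distrib add_divide_distrib) (simp add: \<mu>_def)
    ultimately show ?thesis using c \<nu>
      by (intro exI[of _ \<mu>]) (auto simp: \<mu>_def)
  qed
qed

section \<open>Reversible chains and Cesaro means\<close>

text \<open>Jensen's inequality; the deficit is the variance about the weighted mean.\<close>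

lemma norm_sum_square_le:
  fixes x :: "'j \<Rightarrow> 'h::real_inner"
  assumes "finite J" "\<And>j. j \<in> J \<Longrightarrow> 0 \<le> a j" "(\<Sum>j\<in>J. a j) = 1"
  shows "(norm (\<Sum>j\<in>J. a j *\<^sub>R x j))\<^sup>2 \<le> (\<Sum>j\<in>J. a j * (norm (x j))\<^sup>2)"
proof -
  define m where "m = (\<Sum>j\<in>J. a j *\<^sub>R x j)"
  have "0 \<le> (\<Sum>j\<in>J. a j * (norm (x j - m))\<^sup>2)"
    using assms by (intro sum_nonneg) auto
  also have "\<dots> = (\<Sum>j\<in>J. a j * (norm (x j))\<^sup>2) - 2 * ((\<Sum>j\<in>J. a j *\<^sub>R x j) \<bullet> m) + (\<Sum>j\<in>J. a j) * (norm m)\<^sup>2"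
    unfolding inner_sum_left sum_distrib_left sum_distrib_right sum_subtractf[symmetric] sum.distrib[symmetric]
    by (intro sum.cong refl) (simp add: power2_norm_eq_inner inner_diff_left inner_diff_right inner_commute algebra_simps)
  also have "\<dots> = (\<Sum>j\<in>J. a j * (norm (x j))\<^sup>2) - (norm m)\<^sup>2"
    using assms(3) by (simp add: m_def[symmetric] power2_norm_eq_inner)
  finally show ?thesis by (simp add: m_def)
qed

lemma rev_markov_chainD:
  assumes "rev_markov_chain n w P"
  shows "\<And>i. i < n \<Longrightarrow> 0 \<le> w i" "(\<Sum>i<n. w i) = 1"
    "\<And>i j. i < n \<Longrightarrow> j < n \<Longrightarrow> 0 \<le> P i j" "\<And>i. i < n \<Longrightarrow> (\<Sum>j<n. P i j) = 1"
    "\<And>i j. i < n \<Longrightarrow> j < n \<Longrightarrow> w i * P i j = w j * P j i"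
    "\<And>j. j < n \<Longrightarrow> (\<Sum>i<n. w i * P i j) = w j"
  using assms unfolding rev_markov_chain_def by auto

lemma mat_pow_add:
  assumes "i < n" "j < n"
  shows "mat_pow n P (s + t) i j = (\<Sum>k<n. mat_pow n P s i k * mat_pow n P t k j)"
  using assms
proof (induction t arbitrary: j)
  case 0
  have "(\<Sum>k<n. mat_pow n P s i k * mat_pow n P 0 k j) = (\<Sum>k<n. if k = j then mat_pow n P s i k else 0)"
    by (intro sum.cong) auto
  also have "\<dots> = mat_pow n P s i j" using 0 by simp
  finally show ?case by simp
next
  case (Suc t)
  have "mat_pow n P (s + Suc t) i j = (\<Sum>l<n. (\<Sum>k<n. mat_pow n P s i k * mat_pow n P t k l) * P l j)"
    using Suc by simp
  also have "\<dots> = (\<Sum>k<n. mat_pow n P s i k * (\<Sum>l<n. mat_pow n P t k l * P l j))"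
    unfolding sum_distrib_left sum_distrib_right by (subst sum.swap) (simp add: mult.assoc)
  finally show ?case by simp
qed

lemma mat_pow_1: "i < n \<Longrightarrow> mat_pow n P 1 i j = P i j"
proof -
  assume i: "i < n"
  have "mat_pow n P 1 i j = (\<Sum>k<n. if k = i then P k j else 0)"
    unfolding One_nat_def mat_pow.simps by (intro sum.cong) auto
  then show ?thesis using i by simp
qed

lemma mat_pow_Suc_left:
  "i < n \<Longrightarrow> j < n \<Longrightarrow> mat_pow n P (Suc t) i j = (\<Sum>k<n. P i k * mat_pow n P t k j)"
  using mat_pow_add[of i n j P 1 t] by (simp add: mat_pow_1[unfolded One_nat_def] del: mat_pow.simps)

lemma mat_pow_nonneg:
  assumes "rev_markov_chain n w P" "i < n" "j < n"
  shows "0 \<le> mat_pow n P t i j"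
  using assms(2,3) rev_markov_chainD(3)[OF assms(1)]
  by (induction t arbitrary: j) (auto intro!: sum_nonneg)

lemma mat_pow_row_sum:
  assumes "rev_markov_chain n w P" "i < n"
  shows "(\<Sum>j<n. mat_pow n P t i j) = 1"
proof (induction t)
  case 0
  then show ?case using assms(2) by simp
next
  case (Suc t)
  have "(\<Sum>j<n. mat_pow n P (Suc t) i j) = (\<Sum>k<n. mat_pow n P t i k * (\<Sum>j<n. P k j))"
    unfolding mat_pow.simps sum_distrib_left by (rule sum.swap)
  then show ?case using Suc rev_markov_chainD(4)[OF assms(1)] by simp
qed

lemma mat_pow_reversible:
  assumes "rev_markov_chain n w P" "i < n" "j < n"
  shows "w i * mat_pow n P t i j = w j * mat_pow n P t j i"
  using assms(2,3)
proof (induction t arbitrary: i j)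
  case 0
  then show ?case by simp
next
  case (Suc t)
  have "w i * mat_pow n P (Suc t) i j = (\<Sum>k<n. (w i * mat_pow n P t i k) * P k j)"
    by (simp add: sum_distrib_left mult.assoc)
  also have "\<dots> = (\<Sum>k<n. mat_pow n P t k i * (w k * P k j))"
    using Suc by (intro sum.cong) (auto simp: mult.assoc)
  also have "\<dots> = (\<Sum>k<n. w j * (P j k * mat_pow n P t k i))"
    using rev_markov_chainD(5)[OF assms(1)] Suc.prems by (intro sum.cong) (auto simp: algebra_simps)
  also have "\<dots> = w j * mat_pow n P (Suc t) j i"
    using Suc.prems by (simp add: mat_pow_Suc_left sum_distrib_left del: mat_pow.simps)
  finally show ?case .
qed

lemma rev_markov_chain_mat_pow:
  assumes "rev_markov_chain n w P"
  shows "rev_markov_chain n w (mat_pow n P t)"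
proof -
  have "(\<Sum>i<n. w i * mat_pow n P t i j) = w j" if "j < n" for j
  proof -
    have "(\<Sum>i<n. w i * mat_pow n P t i j) = (\<Sum>i<n. w j * mat_pow n P t j i)"
      using mat_pow_reversible[OF assms] that by (intro sum.cong) auto
    also have "\<dots> = w j" using mat_pow_row_sum[OF assms that] by (simp add: sum_distrib_left[symmetric])
    finally show ?thesis .
  qed
  then show ?thesis
    using rev_markov_chainD[OF assms] mat_pow_nonneg[OF assms] mat_pow_row_sum[OF assms] mat_pow_reversible[OF assms]
    unfolding rev_markov_chain_def by auto
qed

text \<open>Both marginals of the weights \<open>w i * P i j\<close> are \<open>w\<close>, so the
  two squares contribute equally.\<close>

lemma dirichlet_form_expand:
  fixes x :: "nat \<Rightarrow> 'h::real_inner"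
  assumes "rev_markov_chain n w P"
  shows "(\<Sum>i<n. \<Sum>j<n. w i * P i j * (norm (x i - x j))\<^sup>2) =
    2 * (\<Sum>i<n. w i * (norm (x i))\<^sup>2) - 2 * (\<Sum>i<n. \<Sum>j<n. w i * P i j * (x i \<bullet> x j))"
proof -
  have 1: "(\<Sum>i<n. \<Sum>j<n. w i * P i j * (norm (x i))\<^sup>2) = (\<Sum>i<n. w i * (norm (x i))\<^sup>2)"
    using rev_markov_chainD(4)[OF assms]
    by (intro sum.cong) (auto simp: sum_distrib_left[symmetric] sum_distrib_right[symmetric])
  have 2: "(\<Sum>i<n. \<Sum>j<n. w i * P i j * (norm (x j))\<^sup>2) = (\<Sum>i<n. w i * (norm (x i))\<^sup>2)"
    using rev_markov_chainD(6)[OF assms]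
    by (subst sum.swap) (intro sum.cong, auto simp: sum_distrib_left[symmetric] sum_distrib_right[symmetric])
  have "(\<Sum>i<n. \<Sum>j<n. w i * P i j * (norm (x i - x j))\<^sup>2) =
     (\<Sum>i<n. \<Sum>j<n. w i * P i j * (norm (x i))\<^sup>2) + (\<Sum>i<n. \<Sum>j<n. w i * P i j * (norm (x j))\<^sup>2)
     - 2 * (\<Sum>i<n. \<Sum>j<n. w i * P i j * (x i \<bullet> x j))"
    unfolding sum_distrib_left sum.distrib[symmetric] sum_subtractf[symmetric]
    by (intro sum.cong refl) (simp add: power2_norm_eq_inner inner_diff_left inner_diff_right inner_commute algebra_simps)
  then show ?thesis using 1 2 by simp
qed

definition cesaro_mean :: "nat \<Rightarrow> (nat \<Rightarrow> nat \<Rightarrow> real) \<Rightarrow> nat \<Rightarrow> (nat \<Rightarrow> 'h::real_inner) \<Rightarrow> nat \<Rightarrow> 'h" where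
  "cesaro_mean n P T u i = (\<Sum>t<T. (1 / real T) *\<^sub>R (\<Sum>j<n. mat_pow n P t i j *\<^sub>R u j))"

context
  fixes n w P T B and u :: "nat \<Rightarrow> 'h::real_inner"
  assumes chain: "rev_markov_chain n w P" and T: "0 < T"
    and bound: "\<And>t. t \<le> 2 * T \<Longrightarrow> (\<Sum>i<n. \<Sum>j<n. w i * mat_pow n P t i j * (norm (u i - u j))\<^sup>2) \<le> B"
begin

text \<open>Jensen over the time and then over the transition law: only displacements at times below
  \<open>T\<close> enter.\<close>

lemma cesaro_mean_close:
  "(\<Sum>i<n. w i * (norm (cesaro_mean n P T u i - u i))\<^sup>2) \<le> B"
proof -
  have pt: "(norm (cesaro_mean n P T u i - u i))\<^sup>2 \<le>
      (\<Sum>t<T. (1 / real T) * (\<Sum>j<n. mat_pow n P t i j * (norm (u i - u j))\<^sup>2))" if i: "i < n" for i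
  proof -
    have g: "(\<Sum>j<n. mat_pow n P t i j *\<^sub>R u j) - u i = (\<Sum>j<n. mat_pow n P t i j *\<^sub>R (u j - u i))" for t
      using mat_pow_row_sum[OF chain i]
      by (simp add: scaleR_diff_right sum_subtractf scaleR_left.sum[symmetric])
    have "(\<Sum>t<T. 1 / real T) = 1" using T by simp
    then have "cesaro_mean n P T u i - u i =
        (\<Sum>t<T. (1 / real T) *\<^sub>R ((\<Sum>j<n. mat_pow n P t i j *\<^sub>R u j) - u i))"
      unfolding cesaro_mean_def scaleR_diff_right sum_subtractf scaleR_left.sum[symmetric] by simp
    then have "(norm (cesaro_mean n P T u i - u i))\<^sup>2 \<le>
        (\<Sum>t<T. (1 / real T) * (norm ((\<Sum>j<n. mat_pow n P t i j *\<^sub>R u j) - u i))\<^sup>2)"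
      using T by (simp only:) (intro norm_sum_square_le, auto)
    also have "\<dots> \<le> (\<Sum>t<T. (1 / real T) * (\<Sum>j<n. mat_pow n P t i j * (norm (u j - u i))\<^sup>2))"
      unfolding g using mat_pow_nonneg[OF chain i] mat_pow_row_sum[OF chain i]
      by (intro sum_mono mult_left_mono norm_sum_square_le) auto
    finally show ?thesis by (simp add: norm_minus_commute)
  qed
  have "(\<Sum>i<n. w i * (norm (cesaro_mean n P T u i - u i))\<^sup>2) \<le>
     (\<Sum>i<n. w i * (\<Sum>t<T. (1 / real T) * (\<Sum>j<n. mat_pow n P t i j * (norm (u i - u j))\<^sup>2)))"
    using pt rev_markov_chainD(1)[OF chain] by (intro sum_mono mult_left_mono) auto
  also have "\<dots> = (\<Sum>t<T. (1 / real T) * (\<Sum>i<n. \<Sum>j<n. w i * mat_pow n P t i j * (norm (u i - u j))\<^sup>2))"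
    unfolding sum_distrib_left by (subst sum.swap) (simp add: algebra_simps)
  also have "\<dots> \<le> (\<Sum>t<T. (1 / real T) * B)"
    using bound by (intro sum_mono mult_left_mono) auto
  also have "\<dots> = B" using T by simp
  finally show ?thesis .
qed

text \<open>Reversibility makes the inner product of \<open>P^s u\<close> and \<open>P^t u\<close> a
  function \<open>b\<close> of \<open>s + t\<close> alone. The energy becomes a double sum of
  \<open>b (s + t) - b (s + t + 1)\<close>, which telescopes in \<open>t\<close> and leaves only
  \<open>T\<close> of the \<open>T^2\<close> terms.\<close>

lemma cesaro_mean_energy:
  "T * (\<Sum>i<n. \<Sum>j<n. w i * P i j * (norm (cesaro_mean n P T u i - cesaro_mean n P T u j))\<^sup>2) \<le> B"
proof -
  define g where "g t i = (\<Sum>j<n. mat_pow n P t i j *\<^sub>R u j)" for t i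
  define b where "b t = (\<Sum>i<n. \<Sum>j<n. w i * mat_pow n P t i j * (u i \<bullet> u j))" for t
  have F: "cesaro_mean n P T u i = (\<Sum>t<T. (1 / real T) *\<^sub>R g t i)" for i
    by (simp add: cesaro_mean_def g_def)
  have gg: "(\<Sum>i<n. w i * (g s i \<bullet> g t i)) = b (s + t)" for s t
  proof -
    have "(\<Sum>i<n. w i * (g s i \<bullet> g t i)) =
        (\<Sum>i<n. \<Sum>j<n. \<Sum>k<n. (w i * mat_pow n P s i j) * mat_pow n P t i k * (u j \<bullet> u k))"
      unfolding g_def inner_sum_left inner_sum_right sum_distrib_left by (rule sum.cong[OF refl], subst sum.swap) (simp add: ac_simps)
    also have "\<dots> = (\<Sum>i<n. \<Sum>j<n. \<Sum>k<n. (w j * mat_pow n P s j i) * mat_pow n P t i k * (u j \<bullet> u k))"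
      using mat_pow_reversible[OF chain] by (intro sum.cong refl) (metis lessThan_iff)
    also have "\<dots> = (\<Sum>j<n. \<Sum>k<n. \<Sum>i<n. (w j * mat_pow n P s j i) * mat_pow n P t i k * (u j \<bullet> u k))"
      by (subst sum.swap, rule sum.cong[OF refl], rule sum.swap)
    also have "\<dots> = b (s + t)"
      unfolding b_def by (intro sum.cong refl) (auto simp: mat_pow_add sum_distrib_left sum_distrib_right mult.assoc)
    finally show ?thesis .
  qed
  have gS: "(\<Sum>j<n. P i j *\<^sub>R g t j) = g (Suc t) i" if "i < n" for i t
  proof -
    have "(\<Sum>j<n. P i j *\<^sub>R g t j) = (\<Sum>j<n. \<Sum>k<n. (P i j * mat_pow n P t j k) *\<^sub>R u k)"
      by (simp add: g_def scaleR_sum_right)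
    also have "\<dots> = (\<Sum>k<n. (\<Sum>j<n. P i j * mat_pow n P t j k) *\<^sub>R u k)"
      by (subst sum.swap) (simp add: scaleR_left.sum)
    also have "\<dots> = g (Suc t) i"
      unfolding g_def using that by (intro sum.cong) (auto simp: mat_pow_Suc_left simp del: mat_pow.simps)
    finally show ?thesis .
  qed
  have PF: "(\<Sum>j<n. P i j *\<^sub>R cesaro_mean n P T u j) = (\<Sum>t<T. (1 / real T) *\<^sub>R g (Suc t) i)" if "i < n" for i
  proof -
    have "(\<Sum>j<n. P i j *\<^sub>R cesaro_mean n P T u j) = (\<Sum>t<T. (1 / real T) *\<^sub>R (\<Sum>j<n. P i j *\<^sub>R g t j))"
      unfolding F scaleR_sum_right by (subst sum.swap) (simp add: mult.commute)
    then show ?thesis using gS[OF that] by simp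
  qed
  have e1: "(\<Sum>i<n. w i * (norm (cesaro_mean n P T u i))\<^sup>2) = (\<Sum>s<T. \<Sum>t<T. (1 / (real T)\<^sup>2) * b (s + t))"
  proof -
    have "(\<Sum>i<n. w i * (norm (cesaro_mean n P T u i))\<^sup>2) = (\<Sum>i<n. \<Sum>s<T. \<Sum>t<T. (1 / (real T)\<^sup>2) * (w i * (g s i \<bullet> g t i)))"
      unfolding power2_norm_eq_inner F inner_sum_left inner_sum_right sum_distrib_left
      by (intro sum.cong refl) (simp add: power2_eq_square inner_commute)
    also have "\<dots> = (\<Sum>s<T. \<Sum>t<T. (1 / (real T)\<^sup>2) * (\<Sum>i<n. w i * (g s i \<bullet> g t i)))"
      unfolding sum_distrib_left by (subst sum.swap, rule sum.cong[OF refl], rule sum.swap)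
    finally show ?thesis unfolding gg .
  qed
  have "(\<Sum>i<n. \<Sum>j<n. w i * P i j * (cesaro_mean n P T u i \<bullet> cesaro_mean n P T u j)) =
      (\<Sum>i<n. w i * (cesaro_mean n P T u i \<bullet> (\<Sum>j<n. P i j *\<^sub>R cesaro_mean n P T u j)))"
    by (simp add: inner_sum_right sum_distrib_left mult.assoc)
  also have "\<dots> = (\<Sum>i<n. w i * ((\<Sum>s<T. (1 / real T) *\<^sub>R g s i) \<bullet> (\<Sum>t<T. (1 / real T) *\<^sub>R g (Suc t) i)))"
    using PF by (intro sum.cong) (auto simp: F)
  also have "\<dots> = (\<Sum>i<n. \<Sum>s<T. \<Sum>t<T. (1 / (real T)\<^sup>2) * (w i * (g s i \<bullet> g (Suc t) i)))"
    unfolding inner_sum_left inner_sum_right sum_distrib_left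
    by (rule sum.cong[OF refl], subst sum.swap) (simp add: power2_eq_square)
  also have "\<dots> = (\<Sum>s<T. \<Sum>t<T. (1 / (real T)\<^sup>2) * (\<Sum>i<n. w i * (g s i \<bullet> g (Suc t) i)))"
    unfolding sum_distrib_left by (subst sum.swap, rule sum.cong[OF refl], rule sum.swap)
  finally have e2: "(\<Sum>i<n. \<Sum>j<n. w i * P i j * (cesaro_mean n P T u i \<bullet> cesaro_mean n P T u j)) =
      (\<Sum>s<T. \<Sum>t<T. (1 / (real T)\<^sup>2) * b (s + Suc t))" unfolding gg .
  \<comment> \<open>After the common norm term cancels, this difference is the displacement at time
    \<open>s + T\<close> minus the one at time \<open>s\<close>. As \<open>s + T < 2 * T\<close>,
    the assumed bound has to reach twice the averaging time.\<close>
  have D: "2 * b s - 2 * b (s + T) \<le> B" if "s < T" for s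
  proof -
    have "(\<Sum>i<n. \<Sum>j<n. w i * mat_pow n P (s + T) i j * (norm (u i - u j))\<^sup>2) \<le> B"
      using bound that by auto
    moreover have "0 \<le> (\<Sum>i<n. \<Sum>j<n. w i * mat_pow n P s i j * (norm (u i - u j))\<^sup>2)"
      using rev_markov_chainD(1)[OF chain] mat_pow_nonneg[OF chain] by (intro sum_nonneg) auto
    ultimately show ?thesis
      unfolding dirichlet_form_expand[OF rev_markov_chain_mat_pow[OF chain]] b_def by linarith
  qed
  have "(\<Sum>i<n. \<Sum>j<n. w i * P i j * (norm (cesaro_mean n P T u i - cesaro_mean n P T u j))\<^sup>2)
     = (\<Sum>s<T. (1 / (real T)\<^sup>2) * (2 * (\<Sum>t<T. b (s + t) - b (s + Suc t))))"
    unfolding dirichlet_form_expand[OF chain] e1 e2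
    by (simp add: sum_distrib_left right_diff_distrib sum_subtractf mult.left_commute)
  also have "\<dots> = (\<Sum>s<T. (1 / (real T)\<^sup>2) * (2 * b s - 2 * b (s + T)))"
    unfolding sum_lessThan_telescope'[of "\<lambda>t. b (_ + t)"] by simp
  also have "\<dots> \<le> (\<Sum>s<T. (1 / (real T)\<^sup>2) * B)"
    using D by (intro sum_mono mult_left_mono) auto
  also have "\<dots> = B / T" using T by (simp add: power2_eq_square)
  finally show ?thesis using T by (simp add: divide_simps mult.commute)
qed

end

section \<open>Lipschitz approximation on finite sets\<close>

definition markov_bound :: "real \<Rightarrow> 'a::metric_space set \<Rightarrow> bool" where
  "markov_bound M X \<longleftrightarrow> (\<forall>n w P (f::nat \<Rightarrow> 'a) (t::nat).
     rev_markov_chain n w P \<and> (\<forall>i<n. f i \<in> X) \<longrightarrow>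
       (\<Sum>i<n. \<Sum>j<n. w i * mat_pow n P t i j * (dist (f i) (f j))\<^sup>2)
         \<le> M\<^sup>2 * real t * (\<Sum>i<n. \<Sum>j<n. w i * P i j * (dist (f i) (f j))\<^sup>2))"

lemma markov_type_2_iff: "markov_type 2 X \<longleftrightarrow> (\<exists>M>0. markov_bound M X)"
  unfolding markov_type_def markov_bound_def by (rule ex_cong) (simp add: powr_numeral)

text \<open>Rates \<open>c\<close> and masses \<open>m\<close> become a lazy chain with stationary measure proportional to \<open>m\<close>,
  run for \<open>T\<close> steps of size \<open>1/T\<close>.\<close>

lemma weighted_smoothing:
  fixes f :: "nat \<Rightarrow> 'a::metric_space" and u :: "nat \<Rightarrow> 'h::real_inner"
  assumes X: "markov_bound M X" "\<And>i. i < n \<Longrightarrow> f i \<in> X" and n: "0 < n"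
    and u: "\<And>i j. i < n \<Longrightarrow> j < n \<Longrightarrow> norm (u i - u j) \<le> \<omega> * (1 + dist (f i) (f j) / \<epsilon>)"
    and pos: "0 < \<omega>" "0 < \<epsilon>"
    and c: "\<And>i j. i < n \<Longrightarrow> j < n \<Longrightarrow> 0 \<le> c i j" "\<And>i j. i < n \<Longrightarrow> j < n \<Longrightarrow> c i j = c j i"
    and m: "\<And>i. i < n \<Longrightarrow> 0 < m i"
  shows "\<exists>F :: nat \<Rightarrow> 'h. (\<Sum>i<n. \<Sum>j<n. c i j * (norm (F i - F j))\<^sup>2) + (\<Sum>i<n. m i * (norm (F i - u i))\<^sup>2)
     \<le> 4 * \<omega>\<^sup>2 * (\<Sum>i<n. m i) + 8 * \<omega>\<^sup>2 * M\<^sup>2 / \<epsilon>\<^sup>2 * (\<Sum>i<n. \<Sum>j<n. c i j * (dist (f i) (f j))\<^sup>2)"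
proof -
  define mt where "mt = (\<Sum>i<n. m i)"
  have mt: "0 < mt" unfolding mt_def using m n by (intro sum_pos) auto
  define r where "r i = (\<Sum>j\<in>{..<n}-{i}. c i j) / m i" for i
  have r0: "0 \<le> r i" if "i < n" for i
    unfolding r_def using c m[OF that] that by (intro divide_nonneg_pos sum_nonneg) auto
  \<comment> \<open>\<open>T0\<close> dominates every jump rate, so the holding probabilities on the
    diagonal of \<open>P\<close> are nonnegative.\<close>
  obtain T0 :: nat where T0: "(\<Sum>i<n. r i) < T0" using reals_Archimedean2 by blast
  have T: "0 < T0" using T0 r0 by (metis lessThan_iff less_irrefl of_nat_0 not_gr_zero sum_nonneg not_le)
  have rT: "r i \<le> T0" if "i < n" for i
    using member_le_sum[of i "{..<n}" r] r0 T0 that by force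
  define w where "w i = m i / mt" for i
  define P where "P i j = (if i = j then 1 - r i / T0 else c i j / (T0 * m i))" for i j
  have wP: "w i * P i j = c i j / (T0 * mt)" if "i < n" "i \<noteq> j" for i j
    using m[OF that(1)] that by (simp add: w_def P_def)
  have sym: "w i * P i j = w j * P j i" if "i < n" "j < n" for i j
  proof (cases "i = j")
    case False
    then show ?thesis using wP[of i j] wP[of j i] c(2)[of i j] that by simp
  qed simp
  have row: "(\<Sum>j<n. P i j) = 1" if i: "i < n" for i
  proof -
    have "(\<Sum>j<n. P i j) = P i i + (\<Sum>j\<in>{..<n}-{i}. P i j)" using i by (simp add: sum.remove)
    also have "(\<Sum>j\<in>{..<n}-{i}. P i j) = (\<Sum>j\<in>{..<n}-{i}. c i j / (T0 * m i))"
      by (intro sum.cong) (auto simp: P_def)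
    also have "\<dots> = r i / T0" by (simp add: r_def sum_divide_distrib mult.commute)
    finally show ?thesis by (simp add: P_def)
  qed
  have chain: "rev_markov_chain n w P"
    unfolding rev_markov_chain_def
  proof (intro conjI allI impI)
    show "0 \<le> w i" if "i < n" for i using m[OF that] mt by (simp add: w_def)
    show "(\<Sum>i<n. w i) = 1" using mt by (simp add: w_def sum_divide_distrib[symmetric] mt_def[symmetric])
    show "0 \<le> P i j" if "i < n" "j < n" for i j
      using rT[OF that(1)] c(1)[OF that] m[OF that(1)] T by (auto simp: P_def)
    show "(\<Sum>j<n. P i j) = 1" if "i < n" for i using row that .
    show "w i * P i j = w j * P j i" if "i < n" "j < n" for i j using sym that .
    show "(\<Sum>i<n. w i * P i j) = w j" if j: "j < n" for j
    proof -
      have "(\<Sum>i<n. w i * P i j) = (\<Sum>i<n. w j * P j i)" using sym j by (intro sum.cong) auto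
      then show ?thesis using row[OF j] by (simp add: sum_distrib_left[symmetric])
    qed
  qed
  \<comment> \<open>Holding steps do not move the point, so they drop out of any form that vanishes
    on the diagonal.\<close>
  have conv: "(\<Sum>i<n. \<Sum>j<n. w i * P i j * q i j) = (\<Sum>i<n. \<Sum>j<n. c i j * q i j) / (T0 * mt)"
    if "\<And>i. q i i = 0" for q :: "nat \<Rightarrow> nat \<Rightarrow> real"
    unfolding sum_divide_distrib
  proof (intro sum.cong refl)
    fix i j assume "i \<in> {..<n}" "j \<in> {..<n}"
    then show "w i * P i j * q i j = c i j * q i j / (T0 * mt)"
      using wP[of i j] that by (cases "i = j") auto
  qed
  define E where "E = (\<Sum>i<n. \<Sum>j<n. c i j * (dist (f i) (f j))\<^sup>2)"
  \<comment> \<open>\<open>(1 + a)^2\<close> is at most \<open>2 + 2 a^2\<close>, and the time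
    horizon \<open>2 * T0\<close> cancels the step size \<open>1 / T0\<close>. Energy and distance
    to \<open>u\<close> each cost \<open>mt * B\<close>; the constants 4 and 8 of the statement are
    those of \<open>2 * (mt * B)\<close>.\<close>
  define B where "B = 2 * \<omega>\<^sup>2 * (1 + 2 * M\<^sup>2 / \<epsilon>\<^sup>2 * (E / mt))"
  have E0: "0 \<le> E" unfolding E_def using c by (intro sum_nonneg) auto
  have bound: "(\<Sum>i<n. \<Sum>j<n. w i * mat_pow n P t i j * (norm (u i - u j))\<^sup>2) \<le> B" if t: "t \<le> 2 * T0" for t
  proof -
    note Q = rev_markov_chainD[OF rev_markov_chain_mat_pow[OF chain, of t]]
    have pt: "(norm (u i - u j))\<^sup>2 \<le> 2 * \<omega>\<^sup>2 + 2 * \<omega>\<^sup>2 / \<epsilon>\<^sup>2 * (dist (f i) (f j))\<^sup>2" if "i < n" "j < n" for i j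
    proof -
      define a where "a = dist (f i) (f j) / \<epsilon>"
      have "(norm (u i - u j))\<^sup>2 \<le> (\<omega> * (1 + a))\<^sup>2"
        using u[OF that] unfolding a_def by (intro power_mono) auto
      also have "\<dots> = \<omega>\<^sup>2 * (1 + a)\<^sup>2" by (simp add: power_mult_distrib)
      also have "\<dots> \<le> \<omega>\<^sup>2 * (2 + 2 * a\<^sup>2)"
        using zero_le_power2[of "1 - a"] by (intro mult_left_mono) (auto simp: power2_eq_square algebra_simps)
      finally show ?thesis using pos by (simp add: a_def power_divide algebra_simps)
    qed
    have "(\<Sum>i<n. \<Sum>j<n. w i * mat_pow n P t i j * (norm (u i - u j))\<^sup>2) \<le>
      (\<Sum>i<n. \<Sum>j<n. w i * mat_pow n P t i j * (2 * \<omega>\<^sup>2 + 2 * \<omega>\<^sup>2 / \<epsilon>\<^sup>2 * (dist (f i) (f j))\<^sup>2))"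
      using pt Q by (intro sum_mono mult_left_mono) auto
    also have "\<dots> = 2 * \<omega>\<^sup>2 * (\<Sum>i<n. w i * (\<Sum>j<n. mat_pow n P t i j))
       + 2 * \<omega>\<^sup>2 / \<epsilon>\<^sup>2 * (\<Sum>i<n. \<Sum>j<n. w i * mat_pow n P t i j * (dist (f i) (f j))\<^sup>2)"
      by (simp add: sum_distrib_left sum.distrib algebra_simps)
    also have "(\<Sum>i<n. w i * (\<Sum>j<n. mat_pow n P t i j)) = 1"
      using Q by simp
    finally have le: "(\<Sum>i<n. \<Sum>j<n. w i * mat_pow n P t i j * (norm (u i - u j))\<^sup>2) \<le> 2 * \<omega>\<^sup>2 * 1
       + 2 * \<omega>\<^sup>2 / \<epsilon>\<^sup>2 * (\<Sum>i<n. \<Sum>j<n. w i * mat_pow n P t i j * (dist (f i) (f j))\<^sup>2)" .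
    have "(\<Sum>i<n. \<Sum>j<n. w i * mat_pow n P t i j * (dist (f i) (f j))\<^sup>2) \<le>
       M\<^sup>2 * real t * (\<Sum>i<n. \<Sum>j<n. w i * P i j * (dist (f i) (f j))\<^sup>2)"
      using X chain unfolding markov_bound_def by blast
    also have "(\<Sum>i<n. \<Sum>j<n. w i * P i j * (dist (f i) (f j))\<^sup>2) = E / (T0 * mt)"
      unfolding E_def by (rule conv) simp
    also have "M\<^sup>2 * real t * (E / (T0 * mt)) \<le> M\<^sup>2 * real (2 * T0) * (E / (T0 * mt))"
      using t E0 mt by (intro mult_right_mono mult_left_mono) (auto simp del: of_nat_mult)
    also have "\<dots> = 2 * M\<^sup>2 * (E / mt)" using T by simp
    finally have "2 * \<omega>\<^sup>2 / \<epsilon>\<^sup>2 * (\<Sum>i<n. \<Sum>j<n. w i * mat_pow n P t i j * (dist (f i) (f j))\<^sup>2)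
        \<le> 2 * \<omega>\<^sup>2 / \<epsilon>\<^sup>2 * (2 * M\<^sup>2 * (E / mt))"
      using pos by (intro mult_left_mono) auto
    with le show ?thesis by (simp add: B_def algebra_simps)
  qed
  define F where "F = cesaro_mean n P T0 u"
  have "(\<Sum>i<n. w i * (norm (F i - u i))\<^sup>2) \<le> B"
    unfolding F_def by (rule cesaro_mean_close[OF chain T bound])
  then have 1: "(\<Sum>i<n. m i * (norm (F i - u i))\<^sup>2) \<le> mt * B"
    using mt by (simp add: w_def sum_divide_distrib[symmetric] divide_le_eq mult.commute)
  have "T0 * (\<Sum>i<n. \<Sum>j<n. w i * P i j * (norm (F i - F j))\<^sup>2) \<le> B"
    unfolding F_def by (rule cesaro_mean_energy[OF chain T bound])
  moreover have "(\<Sum>i<n. \<Sum>j<n. w i * P i j * (norm (F i - F j))\<^sup>2) = (\<Sum>i<n. \<Sum>j<n. c i j * (norm (F i - F j))\<^sup>2) / (T0 * mt)"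
    by (rule conv) simp
  ultimately have 2: "(\<Sum>i<n. \<Sum>j<n. c i j * (norm (F i - F j))\<^sup>2) \<le> mt * B"
    using mt T by (simp add: divide_le_eq mult.commute)
  from 1 2 have "(\<Sum>i<n. \<Sum>j<n. c i j * (norm (F i - F j))\<^sup>2) + (\<Sum>i<n. m i * (norm (F i - u i))\<^sup>2)
     \<le> 2 * (mt * B)" by linarith
  also have "\<dots> = 4 * \<omega>\<^sup>2 * mt + 8 * \<omega>\<^sup>2 * M\<^sup>2 / \<epsilon>\<^sup>2 * E" using mt by (simp add: B_def algebra_simps)
  finally have "(\<Sum>i<n. \<Sum>j<n. c i j * (norm (F i - F j))\<^sup>2) + (\<Sum>i<n. m i * (norm (F i - u i))\<^sup>2)
     \<le> 4 * \<omega>\<^sup>2 * mt + 8 * \<omega>\<^sup>2 * M\<^sup>2 / \<epsilon>\<^sup>2 * E" .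
  then show ?thesis unfolding mt_def E_def by blast
qed

lemma norm_convex_combination_square_le:
  fixes a b :: "'h::real_inner"
  assumes "0 \<le> t" "t \<le> 1"
  shows "(norm ((1 - t) *\<^sub>R a + t *\<^sub>R b))\<^sup>2 \<le> (1 - t) * (norm a)\<^sup>2 + t * (norm b)\<^sup>2"
proof -
  have "(1 - t) * (norm a)\<^sup>2 + t * (norm b)\<^sup>2 - (norm ((1 - t) *\<^sub>R a + t *\<^sub>R b))\<^sup>2 = t * (1 - t) * (norm (a - b))\<^sup>2"
    by (simp add: power2_norm_eq_inner inner_add_left inner_add_right inner_diff_left inner_diff_right inner_commute algebra_simps)
  moreover have "0 \<le> t * (1 - t) * (norm (a - b))\<^sup>2" using assms by simp
  ultimately show ?thesis by linarith
qed

text \<open>If no \<open>F\<close> works, the alternative yields weights under which every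
  \<open>F\<close> uses at least the full allowance on average, while
  \<open>weighted_smoothing\<close> produces an \<open>F\<close> using at most about half of it: 4
  against \<open>3^2 = 9\<close>, and 8 against \<open>4^2 = 16\<close>. The spare room absorbs the
  perturbation \<open>e\<close>.\<close>

lemma finite_lipschitz_approximation:
  fixes f :: "nat \<Rightarrow> 'a::metric_space" and u :: "nat \<Rightarrow> 'h::real_inner"
  assumes X: "markov_bound M X" "\<And>i. i < n \<Longrightarrow> f i \<in> X" and inj: "inj_on f {..<n}"
    and u: "\<And>i j. i < n \<Longrightarrow> j < n \<Longrightarrow> norm (u i - u j) \<le> \<omega> * (1 + dist (f i) (f j) / \<epsilon>)"
    and pos: "0 < \<omega>" "0 < \<epsilon>" "0 < M"
  shows "\<exists>F :: nat \<Rightarrow> 'h. (\<forall>i<n. norm (F i - u i) \<le> 3 * \<omega>) \<and>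
     (\<forall>i<n. \<forall>j<n. norm (F i - F j) \<le> 4 * \<omega> * M / \<epsilon> * dist (f i) (f j))"
proof (rule ccontr)
  assume neg: "\<not> ?thesis"
  define L where "L = 4 * \<omega> * M / \<epsilon>"
  have L0: "0 < L" using pos by (simp add: L_def)
  have n: "0 < n" using neg by auto
  \<comment> \<open>A diagonal pair stands for closeness to \<open>u i\<close>, an off-diagonal pair
    for the Lipschitz constraint. Injectivity of \<open>f\<close> keeps \<open>h\<close> positive
    off the diagonal.\<close>
  define I where "I = {..<n} \<times> {..<n}"
  define h where "h p = (if fst p = snd p then 3 * \<omega> else L * dist (f (fst p)) (f (snd p)))" for p
  define y where "y p F = (if fst p = snd p then F (fst p) - u (fst p) else F (fst p) - F (snd p) :: 'h)" for p F
  have h0: "0 < h p" if "p \<in> I" for p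
    using that pos L0 inj by (auto simp: I_def h_def inj_on_eq_iff)
  have "\<exists>\<nu>. (\<forall>p\<in>I. 0 \<le> \<nu> p) \<and> (\<Sum>p\<in>I. \<nu> p) = (1::real) \<and>
      (\<forall>F\<in>UNIV. 0 \<le> (\<Sum>p\<in>I. \<nu> p * ((norm (y p F))\<^sup>2 - (h p)\<^sup>2)))"
  proof (rule convexlike_alternative)
    show "finite I" by (simp add: I_def)
    show "UNIV \<noteq> ({} :: (nat \<Rightarrow> 'h) set)" by simp
    fix F G :: "nat \<Rightarrow> 'h" and t :: real
    assume t: "0 \<le> t" "t \<le> 1"
    define H where "H i = (1 - t) *\<^sub>R F i + t *\<^sub>R G i" for i
    have yH: "y p H = (1 - t) *\<^sub>R y p F + t *\<^sub>R y p G" for p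
      by (auto simp: y_def H_def algebra_simps)
    have "(norm (y p H))\<^sup>2 - (h p)\<^sup>2 \<le> (1 - t) * ((norm (y p F))\<^sup>2 - (h p)\<^sup>2) + t * ((norm (y p G))\<^sup>2 - (h p)\<^sup>2)" for p
      using norm_convex_combination_square_le[OF t, of "y p F" "y p G"] unfolding yH by (simp add: algebra_simps)
    then show "\<exists>z\<in>UNIV. \<forall>p\<in>I. (norm (y p z))\<^sup>2 - (h p)\<^sup>2 \<le> (1 - t) * ((norm (y p F))\<^sup>2 - (h p)\<^sup>2) + t * ((norm (y p G))\<^sup>2 - (h p)\<^sup>2)"
      by blast
  next
    fix F :: "nat \<Rightarrow> 'h"
    show "\<exists>p\<in>I. 0 \<le> (norm (y p F))\<^sup>2 - (h p)\<^sup>2"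
    proof (rule ccontr)
      assume "\<not> ?thesis"
      then have "(norm (y p F))\<^sup>2 \<le> (h p)\<^sup>2" if "p \<in> I" for p using that by fastforce
      then have le: "norm (y p F) \<le> h p" if "p \<in> I" for p
        using that h0 power2_le_imp_le by (metis less_imp_le)
      have "norm (F i - u i) \<le> 3 * \<omega>" if "i < n" for i
        using le[of "(i, i)"] that by (auto simp: I_def y_def h_def)
      moreover have "norm (F i - F j) \<le> L * dist (f i) (f j)" if "i < n" "j < n" for i j
        using le[of "(i, j)"] that by (cases "i = j") (auto simp: I_def y_def h_def)
      ultimately show False using neg unfolding L_def by blast
    qed
  qed
  then obtain \<nu> where \<nu>: "\<forall>p\<in>I. 0 \<le> \<nu> p" "(\<Sum>p\<in>I. \<nu> p) = (1::real)"
    "\<And>F. 0 \<le> (\<Sum>p\<in>I. \<nu> p * ((norm (y p F))\<^sup>2 - (h p)\<^sup>2))" by blast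
  define S where "S = (\<Sum>p\<in>I. \<nu> p * (h p)\<^sup>2)"
  have "0 < S"
  proof -
    obtain p where p: "p \<in> I" "\<nu> p \<noteq> 0" using \<nu>(2) by (metis sum.neutral zero_neq_one)
    have "0 < \<nu> p * (h p)\<^sup>2" using p \<nu>(1) h0[OF p(1)] by (simp add: less_le)
    then show ?thesis unfolding S_def using \<nu>(1) p(1) by (intro sum_pos2[of _ p]) (auto simp: I_def)
  qed
  \<comment> \<open>Some \<open>\<nu> (i, i)\<close> may vanish, but the chain needs positive
    masses; \<open>e\<close> is chosen so that the added mass costs \<open>S / 4\<close>.\<close>
  define e where "e = S / (2 * (real n * (9 * \<omega>\<^sup>2)))"
  have e0: "0 < e" using \<open>0 < S\<close> n pos by (simp add: e_def)
  \<comment> \<open>The multipliers live on ordered pairs and need not be symmetric. A reversible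
    chain needs symmetric rates, and the constraints do not distinguish \<open>(i, j)\<close> from
    \<open>(j, i)\<close>.\<close>
  define c where "c i j = (if i = j then 0 else (\<nu> (i, j) + \<nu> (j, i)) / 2)" for i j
  define m where "m i = \<nu> (i, i) + e" for i
  have split: "(\<Sum>p\<in>I. \<nu> p * q p) = (\<Sum>i<n. \<Sum>j<n. c i j * q (i, j)) + (\<Sum>i<n. \<nu> (i, i) * q (i, i))"
    if q: "\<And>i j. q (i, j) = q (j, i)" for q :: "nat \<times> nat \<Rightarrow> real"
  proof -
    define k where "k i j = (if i = j then 0 else \<nu> (i, j) * q (i, j))" for i j
    have "(\<Sum>p\<in>I. \<nu> p * q p) = (\<Sum>i<n. \<Sum>j<n. \<nu> (i, j) * q (i, j))"
      unfolding I_def by (simp add: sum.cartesian_product)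
    also have "\<dots> = (\<Sum>i<n. (\<Sum>j<n. k i j) + \<nu> (i, i) * q (i, i))"
    proof (rule sum.cong[OF refl])
      fix i assume i: "i \<in> {..<n}"
      have "(\<Sum>j<n. \<nu> (i, j) * q (i, j)) = (\<Sum>j<n. k i j + (if j = i then \<nu> (i, i) * q (i, i) else 0))"
        by (intro sum.cong) (auto simp: k_def)
      then show "(\<Sum>j<n. \<nu> (i, j) * q (i, j)) = (\<Sum>j<n. k i j) + \<nu> (i, i) * q (i, i)"
        using i by (simp add: sum.distrib)
    qed
    also have "\<dots> = (\<Sum>i<n. \<Sum>j<n. k i j) + (\<Sum>i<n. \<nu> (i, i) * q (i, i))" by (simp add: sum.distrib)
    also have "(\<Sum>i<n. \<Sum>j<n. k i j) = ((\<Sum>i<n. \<Sum>j<n. k i j) + (\<Sum>i<n. \<Sum>j<n. k j i)) / 2"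
      by (subst (3) sum.swap) simp
    also have "\<dots> = (\<Sum>i<n. \<Sum>j<n. c i j * q (i, j))"
      unfolding sum.distrib[symmetric] sum_divide_distrib
    proof (intro sum.cong refl)
      fix i j
      show "(k i j + k j i) / 2 = c i j * q (i, j)"
        using q[of i j] by (auto simp: k_def c_def algebra_simps add_divide_distrib)
    qed
    finally show ?thesis .
  qed
  obtain F :: "nat \<Rightarrow> 'h" where F: "(\<Sum>i<n. \<Sum>j<n. c i j * (norm (F i - F j))\<^sup>2) + (\<Sum>i<n. m i * (norm (F i - u i))\<^sup>2)
     \<le> 4 * \<omega>\<^sup>2 * (\<Sum>i<n. m i) + 8 * \<omega>\<^sup>2 * M\<^sup>2 / \<epsilon>\<^sup>2 * (\<Sum>i<n. \<Sum>j<n. c i j * (dist (f i) (f j))\<^sup>2)"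
  proof -
    have "0 \<le> c i j" "c i j = c j i" "0 < m i" if "i < n" "j < n" for i j
      using \<nu>(1) e0 that by (auto simp: c_def m_def I_def add_nonneg_pos)
    then have "\<exists>F :: nat \<Rightarrow> 'h. (\<Sum>i<n. \<Sum>j<n. c i j * (norm (F i - F j))\<^sup>2) + (\<Sum>i<n. m i * (norm (F i - u i))\<^sup>2)
     \<le> 4 * \<omega>\<^sup>2 * (\<Sum>i<n. m i) + 8 * \<omega>\<^sup>2 * M\<^sup>2 / \<epsilon>\<^sup>2 * (\<Sum>i<n. \<Sum>j<n. c i j * (dist (f i) (f j))\<^sup>2)"
      using X n u pos by (intro weighted_smoothing) auto
    then show thesis using that by blast
  qed
  have cc: "c i j * (norm (y (i, j) F))\<^sup>2 = c i j * (norm (F i - F j))\<^sup>2"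
    "c i j * (h (i, j))\<^sup>2 = c i j * (L\<^sup>2 * (dist (f i) (f j))\<^sup>2)" for i j
    by (auto simp: c_def y_def h_def power_mult_distrib)
  have S1: "S = L\<^sup>2 * (\<Sum>i<n. \<Sum>j<n. c i j * (dist (f i) (f j))\<^sup>2) + 9 * \<omega>\<^sup>2 * (\<Sum>i<n. \<nu> (i, i))"
  proof -
    have "S = (\<Sum>i<n. \<Sum>j<n. c i j * (h (i, j))\<^sup>2) + (\<Sum>i<n. \<nu> (i, i) * (h (i, i))\<^sup>2)"
      unfolding S_def by (rule split) (auto simp: h_def dist_commute)
    then show ?thesis unfolding cc by (simp add: h_def sum_distrib_left algebra_simps)
  qed
  have "S \<le> (\<Sum>p\<in>I. \<nu> p * (norm (y p F))\<^sup>2)"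
    using \<nu>(3)[of F] by (simp add: S_def right_diff_distrib sum_subtractf)
  also have "\<dots> = (\<Sum>i<n. \<Sum>j<n. c i j * (norm (y (i, j) F))\<^sup>2) + (\<Sum>i<n. \<nu> (i, i) * (norm (y (i, i) F))\<^sup>2)"
    by (rule split) (auto simp: y_def norm_minus_commute)
  also have "\<dots> \<le> (\<Sum>i<n. \<Sum>j<n. c i j * (norm (F i - F j))\<^sup>2) + (\<Sum>i<n. m i * (norm (F i - u i))\<^sup>2)"
    unfolding cc using e0 by (intro add_left_mono sum_mono) (auto simp: y_def m_def algebra_simps)
  also note F
  also have "8 * \<omega>\<^sup>2 * M\<^sup>2 / \<epsilon>\<^sup>2 = L\<^sup>2 / 2" by (simp add: L_def power_mult_distrib power_divide)
  also have "4 * \<omega>\<^sup>2 * (\<Sum>i<n. m i) \<le> 9 * \<omega>\<^sup>2 / 2 * (\<Sum>i<n. m i)"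
    using \<nu>(1) e0 by (intro mult_right_mono sum_nonneg) (auto simp: m_def I_def intro!: add_nonneg_nonneg)
  also have "(\<Sum>i<n. m i) = (\<Sum>i<n. \<nu> (i, i)) + n * e" by (simp add: m_def sum.distrib)
  finally have "S \<le> S / 2 + 9 * \<omega>\<^sup>2 / 2 * (n * e)" unfolding S1 by (simp add: algebra_simps add_divide_distrib)
  moreover have "9 * \<omega>\<^sup>2 / 2 * (n * e) = S / 4" using n pos by (simp add: e_def)
  ultimately show False using \<open>0 < S\<close> by linarith
qed

section \<open>Positive semidefinite kernels in \<open>l2\<close>\<close>

lemma square_summable_mult:
  fixes f g :: "'i \<Rightarrow> real"
  assumes "(\<lambda>i. (f i)\<^sup>2) summable_on B" "(\<lambda>i. (g i)\<^sup>2) summable_on B"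
  shows "(\<lambda>i. f i * g i) summable_on B"
proof -
  have "norm (f i * g i) \<le> (f i)\<^sup>2 + (g i)\<^sup>2" for i
  proof -
    have "2 * \<bar>f i\<bar> * \<bar>g i\<bar> \<le> (f i)\<^sup>2 + (g i)\<^sup>2"
      using sum_squares_bound[of "\<bar>f i\<bar>" "\<bar>g i\<bar>"] by simp
    moreover have "0 \<le> \<bar>f i\<bar> * \<bar>g i\<bar>" by simp
    ultimately show ?thesis unfolding real_norm_def abs_mult by linarith
  qed
  then have "(\<lambda>i. norm (f i * g i)) summable_on B"
    by (intro Infinite_Sum.abs_summable_on_comparison_test'[OF summable_on_add[OF assms]])
  then show ?thesis using summable_on_iff_abs_summable_on_real by blast
qed

lemma has_sum_finite_sum:
  fixes f :: "'j \<Rightarrow> 'i \<Rightarrow> real"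
  assumes "finite A" "\<And>z. z \<in> A \<Longrightarrow> (f z has_sum s z) B"
  shows "((\<lambda>y. \<Sum>z\<in>A. f z y) has_sum (\<Sum>z\<in>A. s z)) B"
  using assms by (induction A rule: finite_induct) (auto intro: has_sum_add)

lemma finite_has_greatest:
  assumes "finite F" "F \<noteq> {}" "trans r" "\<And>x y. x \<noteq> y \<Longrightarrow> (x, y) \<in> r \<or> (y, x) \<in> r"
  shows "\<exists>m\<in>F. \<forall>y\<in>F. y = m \<or> (y, m) \<in> r"
  using assms(1,2)
proof (induction F rule: finite_ne_induct)
  case (insert x F)
  then obtain m where m: "m \<in> F" "\<forall>y\<in>F. y = m \<or> (y, m) \<in> r" by blast
  show ?case
  proof (cases "(m, x) \<in> r")
    case True
    then have "(y, x) \<in> r" if "y \<in> F" for y using m(2) that transD[OF assms(3), of y m x] by auto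
    then show ?thesis by auto
  next
    case False
    then have "(x, m) \<in> r" using m(1) assms(4)[of m x] insert.hyps by auto
    then show ?thesis using m by auto
  qed
qed simp

definition quadratic_form :: "('a \<Rightarrow> 'a \<Rightarrow> real) \<Rightarrow> 'a set \<Rightarrow> ('a \<Rightarrow> real) \<Rightarrow> real" where
  "quadratic_form K A c = (\<Sum>x\<in>A. \<Sum>y\<in>A. c x * c y * K x y)"

definition psd_kernel :: "('a \<Rightarrow> 'a \<Rightarrow> real) \<Rightarrow> bool" where
  "psd_kernel K \<longleftrightarrow> (\<forall>x y. K x y = K y x) \<and> (\<forall>A c. finite A \<longrightarrow> 0 \<le> quadratic_form K A c)"

lemma quadratic_nonneg_discriminant:
  fixes q b r :: real
  assumes "\<And>s. 0 \<le> q + 2 * s * b + s\<^sup>2 * r" "0 \<le> r"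
  shows "b\<^sup>2 \<le> q * r"
proof (cases "r = 0")
  case True
  have "b = 0"
  proof (rule ccontr)
    assume "b \<noteq> 0"
    then show False using assms(1)[of "- (q + 1) / (2 * b)"] True by (simp add: field_simps)
  qed
  then show ?thesis using True by simp
next
  case False
  then show ?thesis using assms(1)[of "- b / r"] assms(2) by (simp add: field_simps power2_eq_square)
qed

text \<open>Cauchy-Schwarz in the semi-inner product of \<open>K\<close>, between the combination
  \<open>c\<close> and the point \<open>y\<close>.\<close>

lemma psd_kernel_cauchy:
  assumes K: "psd_kernel K" and A: "finite A"
  shows "(\<Sum>z\<in>A. c z * K z y)\<^sup>2 \<le> quadratic_form K A c * K y y"
proof (rule quadratic_nonneg_discriminant)
  show "0 \<le> K y y" using K[unfolded psd_kernel_def, THEN conjunct2, rule_format, of "{y}" "\<lambda>_. 1"]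
    by (simp add: quadratic_form_def)
next
  fix s :: real
  \<comment> \<open>\<open>y\<close> may or may not belong to \<open>A\<close>, so both coefficient
    vectors are extended by zero to \<open>insert y A\<close>.\<close>
  define d where "d z = (if z \<in> A then c z else 0)" for z
  define e where "e z = (if z = y then s else 0)" for z
  let ?A = "insert y A"
  have sym: "K a b = K b a" for a b using K by (simp add: psd_kernel_def)
  have S: "(\<Sum>z\<in>?A. d z * q z) = (\<Sum>z\<in>A. c z * q z)" for q
    using A by (intro sum.mono_neutral_cong_right) (auto simp: d_def)
  have E: "(\<Sum>z\<in>?A. e z * q z) = s * q y" for q
  proof -
    have "(\<Sum>z\<in>?A. e z * q z) = (\<Sum>z\<in>?A. if z = y then s * q z else 0)"
      by (intro sum.cong) (auto simp: e_def)
    then show ?thesis using A by simp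
  qed
  have "0 \<le> quadratic_form K ?A (\<lambda>z. d z + e z)" using K A by (auto simp: psd_kernel_def)
  also have "\<dots> = (\<Sum>x\<in>?A. d x * (\<Sum>z\<in>?A. d z * K x z)) + (\<Sum>x\<in>?A. d x * (\<Sum>z\<in>?A. e z * K x z))
     + (\<Sum>x\<in>?A. e x * (\<Sum>z\<in>?A. d z * K x z)) + (\<Sum>x\<in>?A. e x * (\<Sum>z\<in>?A. e z * K x z))"
    unfolding quadratic_form_def sum_distrib_left sum.distrib[symmetric]
    by (intro sum.cong refl) (simp add: algebra_simps)
  also have "\<dots> = quadratic_form K A c + (\<Sum>x\<in>A. c x * (s * K x y)) + s * (\<Sum>z\<in>A. c z * K y z) + s * (s * K y y)"
    unfolding S E by (simp add: quadratic_form_def sum_distrib_left mult.assoc)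
  also have "(\<Sum>z\<in>A. c z * K y z) = (\<Sum>z\<in>A. c z * K z y)"
    by (rule sum.cong[OF refl], subst sym[of y], rule refl)
  also have "(\<Sum>x\<in>A. c x * (s * K x y)) = s * (\<Sum>z\<in>A. c z * K z y)"
    by (simp add: sum_distrib_left mult.left_commute)
  also have "quadratic_form K A c + s * (\<Sum>z\<in>A. c z * K z y) + s * (\<Sum>z\<in>A. c z * K z y) + s * (s * K y y)
      = quadratic_form K A c + 2 * s * (\<Sum>z\<in>A. c z * K z y) + s\<^sup>2 * K y y"
    by (simp add: power2_eq_square)
  finally show "0 \<le> quadratic_form K A c + 2 * s * (\<Sum>z\<in>A. c z * K z y) + s\<^sup>2 * K y y" .
qed

lemma infsum_square_sum:
  fixes L :: "'i \<Rightarrow> 'a \<Rightarrow> real"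
  assumes A: "finite A" and sq: "\<And>z. (\<lambda>y. (L y z)\<^sup>2) summable_on B"
  shows "((\<lambda>y. (\<Sum>z\<in>A. c z * L y z)\<^sup>2) has_sum quadratic_form (\<lambda>z z'. \<Sum>\<^sub>\<infinity>y\<in>B. L y z * L y z') A c) B"
proof -
  have eq: "(\<lambda>y. (\<Sum>z\<in>A. c z * L y z)\<^sup>2) = (\<lambda>y. \<Sum>z\<in>A. \<Sum>z'\<in>A. c z * c z' * (L y z * L y z'))"
    unfolding power2_eq_square sum_product by (simp add: ac_simps)
  have "((\<lambda>y. L y z * L y z') has_sum (\<Sum>\<^sub>\<infinity>y\<in>B. L y z * L y z')) B" for z z'
    using square_summable_mult[OF sq sq] by (rule has_sum_infsum)
  then have "((\<lambda>y. c z * c z' * (L y z * L y z')) has_sum c z * c z' * (\<Sum>\<^sub>\<infinity>y\<in>B. L y z * L y z')) B" for z z'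
    by (rule has_sum_cmult_right)
  then have "((\<lambda>y. \<Sum>z'\<in>A. c z * c z' * (L y z * L y z')) has_sum
      (\<Sum>z'\<in>A. c z * c z' * (\<Sum>\<^sub>\<infinity>y\<in>B. L y z * L y z'))) B" for z
    by (rule has_sum_finite_sum[OF A])
  then show ?thesis
    unfolding quadratic_form_def eq by (rule has_sum_finite_sum[OF A])
qed

text \<open>Cholesky factorisation by transfinite recursion along a well-order of the index type:
  \<open>L y z\<close> is the \<open>y\<close>-th coordinate of the vector representing \<open>z\<close>.\<close>

lemma psd_kernel_l2_representation:
  fixes K :: "'a \<Rightarrow> 'a \<Rightarrow> real"
  assumes K: "psd_kernel K"
  shows "\<exists>\<phi> :: 'a \<Rightarrow> 'a \<Rightarrow> real. (\<forall>x. \<phi> x \<in> l2_space) \<and>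
     (\<forall>x y. (l2_dist (\<phi> x) (\<phi> y))\<^sup>2 = K x x + K y y - 2 * K x y)"
proof -
  have sym: "K a b = K b a" for a b using K by (simp add: psd_kernel_def)
  have pos: "0 \<le> quadratic_form K A c" if "finite A" for A c using K that by (simp add: psd_kernel_def)
  obtain r :: "'a rel" where r: "well_order_on UNIV r" using well_order_on by blast
  define lt where "lt = r - Id"
  have wf: "wf lt" using r by (simp add: lt_def well_order_on_def)
  have lin: "linear_order_on UNIV r" using r by (simp add: well_order_on_def)
  have "trans r" "antisym r" "total_on UNIV r"
    using lin by (auto simp: linear_order_on_def partial_order_on_def preorder_on_def)
  then have trans: "trans lt" and total: "\<And>x y. x \<noteq> y \<Longrightarrow> (x, y) \<in> lt \<or> (y, x) \<in> lt"
    by (auto simp: lt_def trans_diff_Id total_on_def)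
  have irrefl: "(x, x) \<notin> lt" for x by (simp add: lt_def)
  define below where "below x = {y. (y, x) \<in> lt}" for x
  \<comment> \<open>The Cholesky formula. At a zero pivot the coordinate is 0, because division by
    zero gives 0; this is the right value, as the numerator vanishes too when the residual is
    positive semidefinite.\<close>
  define Step where "Step L x z = (K z x - (\<Sum>\<^sub>\<infinity>y\<in>below x. L y z * L y x)) / sqrt (K x x - (\<Sum>\<^sub>\<infinity>y\<in>below x. L y x * L y x))"
    for L :: "'a \<Rightarrow> 'a \<Rightarrow> real" and x z
  define L where "L = wfrec lt Step"
  have L: "L x = Step L x" for x
  proof -
    have "L x = Step (cut L lt x) x" unfolding L_def by (rule wfrec[OF wf])
    also have "\<dots> = Step L x"
      unfolding Step_def by (intro ext arg_cong2[where f = "(/)"] arg_cong2[where f = "(-)"] arg_cong[where f = sqrt] refl infsum_cong)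
        (auto simp: below_def cut_apply)
    finally show ?thesis .
  qed
  \<comment> \<open>The Schur complement: what is left of \<open>K\<close> after the coordinates in
    \<open>B\<close>. Accordingly \<open>good B\<close> is Bessel's inequality for these
    coordinates.\<close>
  define R where "R B z z' = K z z' - (\<Sum>\<^sub>\<infinity>y\<in>B. L y z * L y z')" for B z z'
  define good where "good B \<longleftrightarrow> (\<forall>A c. finite A \<longrightarrow>
      (\<lambda>y. (\<Sum>z\<in>A. c z * L y z)\<^sup>2) summable_on B \<and> (\<Sum>\<^sub>\<infinity>y\<in>B. (\<Sum>z\<in>A. c z * L y z)\<^sup>2) \<le> quadratic_form K A c)" for B
  have sq: "(\<lambda>y. (L y z)\<^sup>2) summable_on B" if "good B" for B z
    using that[unfolded good_def, rule_format, of "{z}" "\<lambda>_. 1"] by simp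
  have RB: "quadratic_form (R B) A c = quadratic_form K A c - (\<Sum>\<^sub>\<infinity>y\<in>B. (\<Sum>z\<in>A. c z * L y z)\<^sup>2)"
    if "good B" "finite A" for B A c
  proof -
    have "(\<Sum>\<^sub>\<infinity>y\<in>B. (\<Sum>z\<in>A. c z * L y z)\<^sup>2) = quadratic_form (\<lambda>z z'. \<Sum>\<^sub>\<infinity>y\<in>B. L y z * L y z') A c"
      using infsum_square_sum[where L = L, OF that(2) sq[OF that(1)]] by (rule infsumI)
    then show ?thesis by (simp add: quadratic_form_def R_def right_diff_distrib sum_subtractf)
  qed
  have psdR: "psd_kernel (R B)" if "good B" for B
    using RB[OF that] that sym by (auto simp: psd_kernel_def good_def R_def mult.commute)
  have LR: "L x z = R (below x) z x / sqrt (R (below x) x x)" for x z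
    by (subst L) (simp add: Step_def R_def)
  \<comment> \<open>The new coordinate is the normalised residual pairing with \<open>y\<close>, so
    by Cauchy-Schwarz its square is at most the residual form.\<close>
  have step: "(\<Sum>z\<in>A. c z * L y z)\<^sup>2 + (\<Sum>\<^sub>\<infinity>y'\<in>below y. (\<Sum>z\<in>A. c z * L y' z)\<^sup>2) \<le> quadratic_form K A c"
    if g: "good (below y)" and A: "finite A" for y A c
  proof -
    let ?R = "R (below y)"
    have nn: "0 \<le> quadratic_form ?R A c" using psdR[OF g] A by (simp add: psd_kernel_def)
    have Ryy: "0 \<le> ?R y y"
    proof -
      have "0 \<le> quadratic_form ?R {y} (\<lambda>_. 1)" using psdR[OF g] unfolding psd_kernel_def by blast
      then show ?thesis by (simp add: quadratic_form_def)
    qed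
    have "(\<Sum>z\<in>A. c z * L y z) = (\<Sum>z\<in>A. c z * ?R z y) / sqrt (?R y y)"
      by (simp add: LR sum_divide_distrib)
    then have "(\<Sum>z\<in>A. c z * L y z)\<^sup>2 = (\<Sum>z\<in>A. c z * ?R z y)\<^sup>2 / ?R y y"
      using Ryy by (simp add: power_divide)
    also have "\<dots> \<le> quadratic_form ?R A c"
      using psd_kernel_cauchy[OF psdR[OF g] A, of c y] Ryy nn
      by (cases "?R y y = 0") (auto simp: divide_le_eq)
    finally show ?thesis using RB[OF g A] by simp
  qed
  \<comment> \<open>A finite subset of \<open>B\<close> consists of its greatest element
    \<open>m\<close> and of elements below \<open>m\<close>, so Bessel on \<open>below m\<close>
    plus one step suffices. Successor and limit stages are covered alike.\<close>
  have extend: "good B" if B: "\<And>y. y \<in> B \<Longrightarrow> good (below y)" for B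
    unfolding good_def
  proof (intro allI impI)
    fix A :: "'a set" and c :: "'a \<Rightarrow> real" assume A: "finite A"
    let ?l = "\<lambda>y. (\<Sum>z\<in>A. c z * L y z)\<^sup>2"
    have fin: "sum ?l F \<le> quadratic_form K A c" if F: "finite F" "F \<subseteq> B" for F
    proof (cases "F = {}")
      case True
      then show ?thesis using pos[OF A] by simp
    next
      case False
      obtain m where m: "m \<in> F" "\<forall>y\<in>F. y = m \<or> (y, m) \<in> lt"
        using finite_has_greatest[OF F(1) False trans total] by blast
      have gm: "good (below m)" using B F m by blast
      have "sum ?l F = ?l m + sum ?l (F - {m})" using F m by (simp add: sum.remove)
      also have "sum ?l (F - {m}) \<le> infsum ?l (below m)"
        using gm A F m by (intro finite_sum_le_infsum) (auto simp: good_def below_def)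
      also have "?l m + infsum ?l (below m) \<le> quadratic_form K A c" by (rule step[OF gm A])
      finally show ?thesis by simp
    qed
    have "?l summable_on B"
      using fin by (intro nonneg_bdd_above_summable_on bdd_aboveI2) auto
    then show "?l summable_on B \<and> infsum ?l B \<le> quadratic_form K A c"
      using fin infsum_le_finite_sums by blast
  qed
  have good: "good (below x)" for x
    using wf by (induction x rule: wf_induct_rule) (rule extend, simp add: below_def)
  have gU: "good UNIV" by (rule extend) (rule good)
  \<comment> \<open>Coordinate \<open>x\<close> of the vector of \<open>x\<close> uses up the whole
    residual left after \<open>below x\<close>. With a zero diagonal, Cauchy-Schwarz then kills the
    entire residual kernel.\<close>
  have diag: "R UNIV x x = 0" for x
  proof -
    have "0 \<le> quadratic_form (R UNIV) {x} (\<lambda>_. 1)" using psdR[OF gU] unfolding psd_kernel_def by blast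
    then have "0 \<le> R UNIV x x" by (simp add: quadratic_form_def)
    moreover have "K x x \<le> (\<Sum>\<^sub>\<infinity>y. (L y x)\<^sup>2)"
    proof -
      have "0 \<le> quadratic_form (R (below x)) {x} (\<lambda>_. 1)" using psdR[OF good] unfolding psd_kernel_def by blast
      then have "(L x x)\<^sup>2 = R (below x) x x"
        by (simp add: LR quadratic_form_def real_div_sqrt)
      then have "K x x = (L x x)\<^sup>2 + (\<Sum>\<^sub>\<infinity>y\<in>below x. (L y x)\<^sup>2)"
        by (simp add: R_def power2_eq_square)
      also have "\<dots> = (\<Sum>\<^sub>\<infinity>y\<in>insert x (below x). (L y x)\<^sup>2)"
        using sq[OF good] irrefl by (subst infsum_insert) (auto simp: below_def)
      also have "\<dots> \<le> (\<Sum>\<^sub>\<infinity>y. (L y x)\<^sup>2)"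
        using sq[OF gU] by (intro infsum_mono2) (auto intro: summable_on_subset)
      finally show ?thesis .
    qed
    ultimately show ?thesis by (simp add: R_def power2_eq_square)
  qed
  have KL: "K x y = (\<Sum>\<^sub>\<infinity>i. L i x * L i y)" for x y
  proof -
    have "(R UNIV x y)\<^sup>2 \<le> 0"
      using psd_kernel_cauchy[OF psdR[OF gU], of "{x}" "\<lambda>_. 1" y] by (simp add: quadratic_form_def diag)
    then show ?thesis by (simp add: R_def)
  qed
  define \<phi> where "\<phi> x i = L i x" for x i
  have "(l2_dist (\<phi> x) (\<phi> y))\<^sup>2 = K x x + K y y - 2 * K x y" for x y
  proof -
    have "(l2_dist (\<phi> x) (\<phi> y))\<^sup>2 = (\<Sum>\<^sub>\<infinity>i. (L i x - L i y)\<^sup>2)"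
      unfolding l2_dist_def \<phi>_def by (simp add: infsum_nonneg)
    also have "\<dots> = (\<Sum>\<^sub>\<infinity>i. L i x * L i x + L i y * L i y + (-2) * (L i x * L i y))"
      by (simp add: power2_eq_square algebra_simps)
    also have "\<dots> = (\<Sum>\<^sub>\<infinity>i. L i x * L i x) + (\<Sum>\<^sub>\<infinity>i. L i y * L i y) + (-2) * (\<Sum>\<^sub>\<infinity>i. L i x * L i y)"
      using square_summable_mult[OF sq[OF gU] sq[OF gU]]
      by (intro infsumI has_sum_add has_sum_cmult_right has_sum_infsum)
    finally show ?thesis by (simp add: KL)
  qed
  then show ?thesis using sq[OF gU] by (intro exI[of _ \<phi>]) (auto simp: l2_space_def \<phi>_def)
qed

section \<open>Threshold maps from Markov type 2\<close>

text \<open>Kernels bounded entrywise by \<open>b\<close> form a compact box, and each requirement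
  on a finite set is closed because it reads finitely many entries. It is essential that
  \<open>b\<close> does not depend on \<open>A\<close>. Entries outside \<open>X\<close> are pinned
  to 0, so that the limit is positive semidefinite on the whole type, as the representation in
  \<open>l2\<close> demands.\<close>

lemma kernel_compactness:
  fixes b :: "'a \<Rightarrow> 'a \<Rightarrow> real" and I :: "'a \<Rightarrow> 'a \<Rightarrow> real set"
  assumes fin: "\<And>A. finite A \<Longrightarrow> A \<subseteq> X \<Longrightarrow> \<exists>K. (\<forall>x\<in>A. \<forall>y\<in>A. K x y = K y x \<and> \<bar>K x y\<bar> \<le> b x y
        \<and> K x x + K y y - 2 * K x y \<in> I x y) \<and> (\<forall>c. 0 \<le> quadratic_form K A c)"
    and b0: "\<And>x y. 0 \<le> b x y" and cl: "\<And>x y. closed (I x y)"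
  shows "\<exists>K. psd_kernel K \<and> (\<forall>x\<in>X. \<forall>y\<in>X. K x x + K y y - 2 * K x y \<in> I x y)"
proof -
  define Box where "Box = (\<Pi>\<^sub>E p\<in>UNIV. if fst p \<in> X \<and> snd p \<in> X then {- b (fst p) (snd p)..b (fst p) (snd p)} else {0::real})"
  define C where "C A = (\<Inter>x\<in>A. \<Inter>y\<in>A. {k::'a \<times> 'a \<Rightarrow> real. k (x, y) = k (y, x)} \<inter> {k. k (x, x) + k (y, y) - 2 * k (x, y) \<in> I x y})
      \<inter> (\<Inter>c. {k. 0 \<le> quadratic_form (\<lambda>x y. k (x, y)) A c})" for A
  have "compactin (product_topology (\<lambda>_. euclidean) UNIV) Box"
    unfolding Box_def by (subst compactin_PiE) auto
  then have cpt: "compact Box" by (simp add: euclidean_product_topology)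
  have cont: "continuous_on UNIV (\<lambda>k::'a \<times> 'a \<Rightarrow> real. k p)" for p
    by simp
  have closedC: "closed (C A)" for A
  proof -
    have 1: "closed {k::'a \<times> 'a \<Rightarrow> real. k (x, y) = k (y, x)}" for x y
      by (intro closed_Collect_eq cont)
    have "continuous_on UNIV (\<lambda>k::'a \<times> 'a \<Rightarrow> real. k (x, x) + k (y, y) - 2 * k (x, y))" for x y
      by (intro continuous_on_add continuous_on_diff continuous_on_mult continuous_on_const cont)
    from closed_vimage[OF cl this]
    have 2: "closed {k::'a \<times> 'a \<Rightarrow> real. k (x, x) + k (y, y) - 2 * k (x, y) \<in> I x y}" for x y
      by (simp add: vimage_def)
    have 3: "closed {k::'a \<times> 'a \<Rightarrow> real. 0 \<le> quadratic_form (\<lambda>x y. k (x, y)) A c}" for c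
      unfolding quadratic_form_def
      by (intro closed_Collect_le continuous_on_sum continuous_on_mult continuous_on_const cont)
    show ?thesis unfolding C_def by (intro closed_Int closed_INT ballI 1 2 3)
  qed
  have "Box \<inter> \<Inter> (C ` {A. finite A \<and> A \<subseteq> X}) \<noteq> {}"
  proof (rule compact_imp_fip_image[OF cpt])
    show "closed (C A)" for A by (rule closedC)
  next
    fix \<A> assume \<A>: "finite \<A>" "\<A> \<subseteq> {A. finite A \<and> A \<subseteq> X}"
    \<comment> \<open>A finite family of finite sets is served by the kernel of its union.\<close>
    define A where "A = \<Union>\<A>"
    have A: "finite A" "A \<subseteq> X" using \<A> by (auto simp: A_def)
    obtain K where K: "\<forall>x\<in>A. \<forall>y\<in>A. K x y = K y x \<and> \<bar>K x y\<bar> \<le> b x y \<and> K x x + K y y - 2 * K x y \<in> I x y"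
      "\<forall>c. 0 \<le> quadratic_form K A c" using fin[OF A] by blast

    define k where "k p = (if fst p \<in> A \<and> snd p \<in> A then K (fst p) (snd p) else 0)" for p
    have "k (x, y) \<in> {- b x y..b x y}" for x y
    proof (cases "x \<in> A \<and> y \<in> A")
      case True
      then have "\<bar>K x y\<bar> \<le> b x y" using K(1) by blast
      then show ?thesis using True by (simp add: k_def abs_le_iff)
    next
      case False
      then show ?thesis using b0 by (auto simp: k_def)
    qed
    moreover have "k (x, y) = 0" if "\<not> (x \<in> X \<and> y \<in> X)" for x y using that A(2) by (auto simp: k_def)
    ultimately have "k \<in> Box" unfolding Box_def PiE_UNIV_domain by auto
    moreover have "k \<in> C A'" if A': "A' \<in> \<A>" for A'
    proof -
      have sub: "A' \<subseteq> A" using A' by (auto simp: A_def)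
      have "0 \<le> quadratic_form (\<lambda>x y. k (x, y)) A' c" for c
      proof -
        define d where "d z = (if z \<in> A' then c z else 0)" for z
        have "quadratic_form (\<lambda>x y. k (x, y)) A' c = (\<Sum>x\<in>A'. \<Sum>y\<in>A'. d x * d y * K x y)"
          unfolding quadratic_form_def using sub by (intro sum.cong refl) (auto simp: k_def d_def)
        also have "\<dots> = (\<Sum>x\<in>A'. \<Sum>y\<in>A. d x * d y * K x y)"
          using sub A(1) by (intro sum.cong refl sum.mono_neutral_left) (auto simp: d_def)
        also have "\<dots> = quadratic_form K A d"
          unfolding quadratic_form_def using sub A(1) by (intro sum.mono_neutral_left) (auto simp: d_def)
        finally show ?thesis using K(2) by simp
      qed
      moreover have "k (x, y) = k (y, x)" "k (x, x) + k (y, y) - 2 * k (x, y) \<in> I x y"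
        if "x \<in> A'" "y \<in> A'" for x y using K(1) sub that by (auto simp: k_def)
      ultimately show ?thesis by (simp add: C_def)
    qed
    ultimately show "Box \<inter> \<Inter> (C ` \<A>) \<noteq> {}" by blast
  qed
  then obtain k where k: "k \<in> Box" "\<And>A. finite A \<Longrightarrow> A \<subseteq> X \<Longrightarrow> k \<in> C A" by auto
  define K where "K x y = k (x, y)" for x y
  have out: "K x y = 0" if "x \<notin> X \<or> y \<notin> X" for x y
    using k(1) that by (auto simp: Box_def K_def PiE_iff split: if_splits)
  have pair: "K x y = K y x" "K x x + K y y - 2 * K x y \<in> I x y" if "x \<in> X" "y \<in> X" for x y
  proof -
    have "k \<in> C {x, y}" using that by (intro k(2)) auto
    then show "K x y = K y x" "K x x + K y y - 2 * K x y \<in> I x y"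
      unfolding C_def K_def by blast+
  qed
  have "0 \<le> quadratic_form K A c" if A: "finite A" for A c
  proof -
    have "quadratic_form K A c = (\<Sum>x\<in>A. \<Sum>y\<in>A \<inter> X. c x * c y * K x y)"
      unfolding quadratic_form_def using A out by (intro sum.cong refl sum.mono_neutral_right) auto
    also have "\<dots> = quadratic_form K (A \<inter> X) c"
      unfolding quadratic_form_def using A out by (intro sum.mono_neutral_right) auto
    also have "\<dots> \<ge> 0" using k(2)[of "A \<inter> X"] A unfolding C_def K_def[abs_def] by auto
    finally show ?thesis .
  qed
  moreover have "K x y = K y x" for x y using pair(1) out by metis
  ultimately have "psd_kernel K" by (simp add: psd_kernel_def)
  then show ?thesis using pair(2) by blast
qed

lemma quadratic_form_inner_nonneg:
  fixes v :: "'a \<Rightarrow> 'h::real_inner"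
  shows "0 \<le> quadratic_form (\<lambda>x y. v x \<bullet> v y) A c"
proof -
  have "quadratic_form (\<lambda>x y. v x \<bullet> v y) A c = (\<Sum>x\<in>A. c x *\<^sub>R v x) \<bullet> (\<Sum>y\<in>A. c y *\<^sub>R v y)"
    unfolding quadratic_form_def inner_sum_left inner_sum_right
    by (subst sum.swap) (simp add: mult_ac inner_commute)
  then show ?thesis by simp
qed

text \<open>Two displacements of at most \<open>3 * \<omega>\<close> cost
  \<open>6 * \<omega>\<close> of the separation \<open>7 * \<omega>\<close> and leave
  \<open>\<omega>\<close>. The choice of \<open>\<omega>\<close> normalises the Lipschitz constant
  \<open>4 * \<omega> * M / \<epsilon>\<close> to 1.\<close>

lemma threshold_map_of_coarse_lipschitz:
  fixes X :: "'a::metric_space set" and g :: "'a \<Rightarrow> 'h::real_inner"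
  assumes X: "markov_bound M X" and pos: "0 < M" "0 < \<epsilon>" and \<omega>: "\<omega> = \<epsilon> / (4 * M)"
    and up: "\<And>x y. x \<in> X \<Longrightarrow> y \<in> X \<Longrightarrow> norm (g x - g y) \<le> \<omega> * (1 + dist x y / \<epsilon>)"
    and low: "\<And>x y. x \<in> X \<Longrightarrow> y \<in> X \<Longrightarrow> \<tau> \<le> dist x y \<Longrightarrow> 7 * \<omega> \<le> norm (g x - g y)"
  shows "\<exists>\<phi> :: 'a \<Rightarrow> 'a \<Rightarrow> real. (\<forall>x. \<phi> x \<in> l2_space) \<and> (\<forall>x\<in>X. \<forall>y\<in>X. l2_dist (\<phi> x) (\<phi> y) \<le> dist x y) \<and>
     (\<forall>x\<in>X. \<forall>y\<in>X. \<tau> \<le> dist x y \<longrightarrow> \<omega> \<le> l2_dist (\<phi> x) (\<phi> y))"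
proof (cases "X = {}")
  case True
  then show ?thesis by (intro exI[of _ "\<lambda>_ _. 0"]) (simp add: l2_space_def)
next
  case False
  then obtain o' where o: "o' \<in> X" by blast
  have \<omega>0: "0 < \<omega>" using pos \<omega> by simp
  \<comment> \<open>All approximations stay within \<open>3 * \<omega>\<close> of \<open>g\<close>,
    so their Gram entries relative to the origin \<open>g o'\<close> are bounded by
    \<open>\<beta> x * \<beta> y\<close>, whatever the finite set.\<close>
  define \<beta> where "\<beta> x = 3 * \<omega> + norm (g x - g o')" for x
  define I where "I x y = {(if \<tau> \<le> dist x y then \<omega>\<^sup>2 else 0)..(dist x y)\<^sup>2}" for x y :: 'a
  have "\<exists>K. psd_kernel K \<and> (\<forall>x\<in>X. \<forall>y\<in>X. K x x + K y y - 2 * K x y \<in> I x y)"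
  proof (rule kernel_compactness)
    show "closed (I x y)" for x y by (simp add: I_def)
    show "0 \<le> \<beta> x * \<beta> y" for x y using \<omega>0 by (simp add: \<beta>_def)
    fix A assume A: "finite A" "A \<subseteq> X"
    obtain n f where f: "A = f ` {i::nat. i < n}" "inj_on f {i. i < n}"
      using finite_imp_nat_seg_image_inj_on[OF A(1)] by blast
    have "{i. i < n} = {..<n}" by auto
    note f = f[unfolded this]
    have fX: "f i \<in> X" if "i < n" for i using f(1) A(2) that by auto
    have "\<exists>F :: nat \<Rightarrow> 'h. (\<forall>i<n. norm (F i - g (f i)) \<le> 3 * \<omega>) \<and>
       (\<forall>i<n. \<forall>j<n. norm (F i - F j) \<le> 4 * \<omega> * M / \<epsilon> * dist (f i) (f j))"
    proof (rule finite_lipschitz_approximation[OF X])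
      show "norm (g (f i) - g (f j)) \<le> \<omega> * (1 + dist (f i) (f j) / \<epsilon>)" if "i < n" "j < n" for i j
        using up fX that by blast
    qed (use fX f(2) \<omega>0 pos in auto)
    moreover have "4 * \<omega> * M / \<epsilon> = 1" using pos \<omega> by simp
    ultimately obtain F :: "nat \<Rightarrow> 'h" where F: "\<And>i. i < n \<Longrightarrow> norm (F i - g (f i)) \<le> 3 * \<omega>"
      "\<And>i j. i < n \<Longrightarrow> j < n \<Longrightarrow> norm (F i - F j) \<le> dist (f i) (f j)" by auto
    define G where "G x = F (inv_into {..<n} f x)" for x
    have G: "norm (G x - g x) \<le> 3 * \<omega>" "norm (G x - G y) \<le> dist x y" if xy: "x \<in> A" "y \<in> A" for x y
    proof -
      obtain i j where ij: "x = f i" "i < n" "y = f j" "j < n" using xy unfolding f(1) by blast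
      have "G x = F i" "G y = F j" using ij f(2) by (auto simp: G_def inv_into_f_f)
      then show "norm (G x - g x) \<le> 3 * \<omega>" "norm (G x - G y) \<le> dist x y" using F ij by auto
    qed
    define K where "K x y = (G x - g o') \<bullet> (G y - g o')" for x y
    have Gb: "norm (G x - g o') \<le> \<beta> x" if "x \<in> A" for x
      using norm_triangle_ineq[of "G x - g x" "g x - g o'"] G(1)[OF that that] by (simp add: \<beta>_def)
    have Kd: "K x x + K y y - 2 * K x y = (norm (G x - G y))\<^sup>2" for x y
      by (simp add: K_def power2_norm_eq_inner inner_diff_left inner_diff_right inner_commute algebra_simps)
    show "\<exists>K. (\<forall>x\<in>A. \<forall>y\<in>A. K x y = K y x \<and> \<bar>K x y\<bar> \<le> \<beta> x * \<beta> y
        \<and> K x x + K y y - 2 * K x y \<in> I x y) \<and> (\<forall>c. 0 \<le> quadratic_form K A c)"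
    proof (intro exI[of _ K] conjI ballI allI)
      fix x y assume xy: "x \<in> A" "y \<in> A"
      show "K x y = K y x" by (simp add: K_def inner_commute)
      have "\<bar>K x y\<bar> \<le> norm (G x - g o') * norm (G y - g o')" unfolding K_def by (rule Cauchy_Schwarz_ineq2)
      also have "\<dots> \<le> \<beta> x * \<beta> y" using Gb[OF xy(1)] Gb[OF xy(2)] \<omega>0
        by (intro mult_mono) (auto simp: \<beta>_def)
      finally show "\<bar>K x y\<bar> \<le> \<beta> x * \<beta> y" .
      have "(norm (G x - G y))\<^sup>2 \<le> (dist x y)\<^sup>2" using G(2)[OF xy] by (intro power_mono) auto
      moreover have "\<omega>\<^sup>2 \<le> (norm (G x - G y))\<^sup>2" if "\<tau> \<le> dist x y"
      proof -
        have "7 * \<omega> \<le> norm (g x - g y)" using low xy A(2) that by blast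
        also have "g x - g y = (g x - G x) + (G x - G y) + (G y - g y)" by simp
        also have "norm \<dots> \<le> norm (g x - G x) + norm (G x - G y) + norm (G y - g y)"
          using norm_triangle_ineq[of "(g x - G x) + (G x - G y)" "G y - g y"]
            norm_triangle_ineq[of "g x - G x" "G x - G y"] by linarith
        finally have "\<omega> \<le> norm (G x - G y)"
          using G(1)[OF xy] G(1)[OF xy(2,1)] norm_minus_commute[of "g x" "G x"] by linarith
        then show ?thesis using \<omega>0 by (intro power_mono) auto
      qed
      ultimately show "K x x + K y y - 2 * K x y \<in> I x y" by (auto simp: Kd I_def)
    next
      show "0 \<le> quadratic_form K A c" for c unfolding K_def by (rule quadratic_form_inner_nonneg)
    qed
  qed
  then obtain K where K: "psd_kernel K" "\<And>x y. x \<in> X \<Longrightarrow> y \<in> X \<Longrightarrow> K x x + K y y - 2 * K x y \<in> I x y" by blast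
  obtain \<phi> :: "'a \<Rightarrow> 'a \<Rightarrow> real" where \<phi>: "\<forall>x. \<phi> x \<in> l2_space"
    "\<And>x y. (l2_dist (\<phi> x) (\<phi> y))\<^sup>2 = K x x + K y y - 2 * K x y"
    using psd_kernel_l2_representation[OF K(1)] by blast
  have l0: "0 \<le> l2_dist (\<phi> x) (\<phi> y)" for x y by (simp add: l2_dist_def infsum_nonneg)
  have I: "(l2_dist (\<phi> x) (\<phi> y))\<^sup>2 \<in> I x y" if "x \<in> X" "y \<in> X" for x y using K(2)[OF that] by (simp add: \<phi>(2))
  have "l2_dist (\<phi> x) (\<phi> y) \<le> dist x y" if "x \<in> X" "y \<in> X" for x y
    using I[OF that] by (auto simp: I_def intro: power2_le_imp_le)
  moreover have "\<omega> \<le> l2_dist (\<phi> x) (\<phi> y)" if "x \<in> X" "y \<in> X" "\<tau> \<le> dist x y" for x y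
    using I[OF that(1,2)] that(3) l0[of x y] by (auto simp: I_def intro: power2_le_imp_le)
  ultimately show ?thesis using \<phi>(1) by blast
qed

section \<open>Rescaling a coarse or uniform embedding\<close>

text \<open>Walk along the segment from \<open>y\<close> to \<open>x\<close> in \<open>N\<close>
  equal steps of length at most \<open>\<epsilon>\<close>; rounding \<open>N\<close> up produces the
  summand 1.\<close>

lemma coarse_lipschitz_of_local_bound:
  fixes f :: "'z::real_normed_vector \<Rightarrow> 'h::real_normed_vector"
  assumes loc: "\<And>x y. norm (x - y) \<le> \<epsilon> \<Longrightarrow> norm (f x - f y) \<le> \<omega>" and \<epsilon>: "0 < \<epsilon>"
  shows "norm (f x - f y) \<le> \<omega> * (1 + norm (x - y) / \<epsilon>)"
proof -
  have \<omega>: "0 \<le> \<omega>" using loc[of x x] \<epsilon> by simp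
  define N where "N = nat \<lceil>norm (x - y) / \<epsilon>\<rceil>"
  have N: "norm (x - y) / \<epsilon> \<le> N" "real N \<le> 1 + norm (x - y) / \<epsilon>"
  proof -
    have "0 \<le> \<lceil>norm (x - y) / \<epsilon>\<rceil>" using \<epsilon> by (simp add: order_less_le_trans[OF _ divide_nonneg_pos])
    then have "real N = of_int \<lceil>norm (x - y) / \<epsilon>\<rceil>" by (simp add: N_def)
    then show "norm (x - y) / \<epsilon> \<le> N" "real N \<le> 1 + norm (x - y) / \<epsilon>"
      using ceiling_correct[of "norm (x - y) / \<epsilon>"] by linarith+
  qed
  define d where "d = (1 / real N) *\<^sub>R (x - y)"
  have dn: "norm d \<le> \<epsilon>"
  proof (cases "N = 0")
    case False
    then show ?thesis using N(1) \<epsilon> by (simp add: d_def divide_simps mult.commute)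
  qed (use \<epsilon> in \<open>simp add: d_def\<close>)
  have walk: "norm (f (y + real k *\<^sub>R d) - f y) \<le> k * \<omega>" for k
  proof (induction k)
    case (Suc k)
    have "norm (f (y + real (Suc k) *\<^sub>R d) - f (y + real k *\<^sub>R d)) \<le> \<omega>"
      by (rule loc) (simp add: algebra_simps dn)
    then have "norm ((f (y + real (Suc k) *\<^sub>R d) - f (y + real k *\<^sub>R d)) + (f (y + real k *\<^sub>R d) - f y)) \<le> \<omega> + k * \<omega>"
      using Suc by (intro norm_triangle_le add_mono)
    then show ?case by (simp add: algebra_simps)
  qed simp
  have "y + real N *\<^sub>R d = x"
  proof (cases "N = 0")
    case True
    then show ?thesis using N(1) \<epsilon> by (simp add: divide_le_0_iff)
  qed (simp add: d_def)
  then have "norm (f x - f y) \<le> N * \<omega>" using walk[of N] by simp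
  also have "\<dots> \<le> (1 + norm (x - y) / \<epsilon>) * \<omega>" using N \<omega> by (intro mult_right_mono) auto
  finally show ?thesis by (simp add: mult.commute)
qed

text \<open>A coarse embedding keeps the small scale at 1 and pushes \<open>R\<close> out until
  \<open>\<beta>\<close> is large. A uniform embedding keeps \<open>R = 1\<close>, where continuity
  of the inverse forces a separation \<open>\<delta>\<close>, and shrinks \<open>\<epsilon>\<close>
  until the modulus is \<open>\<delta> / C\<close>.\<close>

lemma embedding_gap:
  fixes f :: "'z::real_normed_vector \<Rightarrow> 'h::real_inner" and C :: real
  assumes "coarse_embedding f \<or> uniform_embedding f" and C: "0 < C"
  shows "\<exists>\<epsilon>>0. \<exists>\<omega>>0. \<exists>R>0. (\<forall>x y. norm (x - y) \<le> \<epsilon> \<longrightarrow> norm (f x - f y) \<le> \<omega>) \<and>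
    (\<forall>x y. R \<le> norm (x - y) \<longrightarrow> C * \<omega> \<le> norm (f x - f y))"
  using assms(1)
proof
  assume "coarse_embedding f"
  then obtain \<alpha> \<beta> :: "real \<Rightarrow> real" where mono: "mono_on {0..} \<alpha>" and a0: "\<forall>t\<ge>0. \<alpha> t \<ge> 0 \<and> \<beta> t \<ge> 0"
    and lim: "filterlim \<beta> at_top at_top"
    and bd: "\<And>x y. \<beta> (dist x y) \<le> dist (f x) (f y)" "\<And>x y. dist (f x) (f y) \<le> \<alpha> (dist x y)"
    unfolding coarse_embedding_def by blast
  \<comment> \<open>\<open>\<alpha> 1\<close> may be 0, hence the summand 1.\<close>
  define \<omega> where "\<omega> = \<alpha> 1 + 1"
  have "0 < \<omega>" using a0[rule_format, of 1] by (simp add: \<omega>_def)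
  obtain R where R: "\<And>t. R \<le> t \<Longrightarrow> C * \<omega> \<le> \<beta> t"
    using lim unfolding filterlim_at_top eventually_at_top_linorder by blast
  have "norm (f x - f y) \<le> \<omega>" if "norm (x - y) \<le> 1" for x y
    using bd(2)[of x y] mono_onD[OF mono, of "dist x y" 1] that by (simp add: \<omega>_def dist_norm)
  moreover have "C * \<omega> \<le> norm (f x - f y)" if "max R 1 \<le> norm (x - y)" for x y
    using R[of "norm (x - y)"] bd(1)[of x y] that by (simp add: dist_norm)
  moreover have "0 < max R 1" by simp
  ultimately show ?thesis using \<open>0 < \<omega>\<close> zero_less_one by blast
next
  assume u: "uniform_embedding f"
  then have inj: "inj f" and uf: "uniformly_continuous_on UNIV f" and ui: "uniformly_continuous_on (range f) (inv f)"
    by (auto simp: uniform_embedding_def)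
  obtain \<delta> where \<delta>: "0 < \<delta>" "\<And>a b. a \<in> range f \<Longrightarrow> b \<in> range f \<Longrightarrow> dist b a < \<delta> \<Longrightarrow> dist (inv f b) (inv f a) < 1"
    using ui unfolding uniformly_continuous_on_def by (metis zero_less_one)
  have "0 < \<delta> / C" using \<delta> C by simp
  then obtain e where e: "0 < e" "\<And>x y. dist x y < e \<Longrightarrow> dist (f x) (f y) < \<delta> / C"
    using uf unfolding uniformly_continuous_on_def by (metis UNIV_I)
  have "norm (f x - f y) \<le> \<delta> / C" if "norm (x - y) \<le> e / 2" for x y
    using e(2)[of x y] that e(1) by (simp add: dist_norm)
  moreover have "C * (\<delta> / C) \<le> norm (f x - f y)" if "1 \<le> norm (x - y)" for x y
    using \<delta>(2)[of "f y" "f x"] that C inj by (cases "norm (f x - f y) < \<delta>") (auto simp: dist_norm)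
  moreover have "0 < e / 2" using e by simp
  ultimately show ?thesis using \<open>0 < \<delta> / C\<close> zero_less_one by blast
qed

lemma threshold_embeds_of_markov_type:
  fixes X :: "'z::real_normed_vector set" and f :: "'z \<Rightarrow> 'h::real_inner"
  assumes f: "coarse_embedding f \<or> uniform_embedding f" and X: "markov_type 2 X"
  shows "threshold_embeds_l2 X"
proof -
  obtain M where M: "0 < M" "markov_bound M X" using X by (auto simp: markov_type_2_iff)
  obtain \<epsilon> \<omega> R :: real where pos: "0 < \<epsilon>" "0 < \<omega>" "0 < R"
    and loc: "\<And>x y. norm (x - y) \<le> \<epsilon> \<Longrightarrow> norm (f x - f y) \<le> \<omega>"
    and low: "\<And>x y. R \<le> norm (x - y) \<Longrightarrow> 7 * \<omega> \<le> norm (f x - f y)"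
    using embedding_gap[OF f, of 7] by auto
  define K where "K = 4 * M * R / \<epsilon>"
  have K0: "0 < K" using pos M by (simp add: K_def)
  have "\<exists>\<phi> :: 'z \<Rightarrow> 'z \<Rightarrow> real. (\<forall>x\<in>X. \<phi> x \<in> l2_space) \<and> (\<forall>x\<in>X. \<forall>y\<in>X. l2_dist (\<phi> x) (\<phi> y) \<le> dist x y) \<and>
     (\<forall>x\<in>X. \<forall>y\<in>X. dist x y \<ge> \<tau> \<longrightarrow> l2_dist (\<phi> x) (\<phi> y) \<ge> \<tau> / K)" if \<tau>: "0 < \<tau>" for \<tau>
  proof -
    \<comment> \<open>Dilating the domain by \<open>s\<close> moves the threshold
      \<open>\<tau>\<close> to \<open>R\<close>. The factor \<open>c\<close> then sets the modulus
      to \<open>\<tau> / K\<close>, which is exactly the value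
      \<open>(\<epsilon> / s) / (4 * M)\<close> that the Lipschitz normalisation asks for. The
      dilated points may leave \<open>X\<close>, but \<open>f\<close> is defined on the whole
      space.\<close>
    define s where "s = R / \<tau>"
    have s: "0 < s" using pos \<tau> by (simp add: s_def)
    have K\<tau>: "\<tau> / K = (\<epsilon> / s) / (4 * M)" using pos M \<tau> by (simp add: K_def s_def mult_ac)
    define c where "c = (\<tau> / K) / \<omega>"
    have c: "0 < c" "c * \<omega> = \<tau> / K" using \<tau> K0 pos by (auto simp: c_def)
    define g where "g x = c *\<^sub>R f (s *\<^sub>R x)" for x
    have gn: "norm (g x - g y) = c * norm (f (s *\<^sub>R x) - f (s *\<^sub>R y))" for x y
      using c by (simp add: g_def scaleR_diff_right[symmetric])
    have sn: "norm (s *\<^sub>R x - s *\<^sub>R y) = s * dist x y" for x y :: 'z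
      using s by (simp add: scaleR_diff_right[symmetric] dist_norm)
    have up: "norm (g x - g y) \<le> \<tau> / K * (1 + dist x y / (\<epsilon> / s))" for x y
    proof -
      have "norm (g x - g y) \<le> c * (\<omega> * (1 + s * dist x y / \<epsilon>))"
        unfolding gn sn[symmetric] using c coarse_lipschitz_of_local_bound[OF loc pos(1)]
        by (intro mult_left_mono) auto
      also have "\<dots> = (c * \<omega>) * (1 + dist x y / (\<epsilon> / s))" by simp
      finally show ?thesis unfolding c(2) .
    qed
    have lo: "7 * (\<tau> / K) \<le> norm (g x - g y)" if "\<tau> \<le> dist x y" for x y
    proof -
      have "R \<le> s * dist x y" using that pos \<tau> by (simp add: s_def divide_simps mult.commute)
      then have "7 * \<omega> \<le> norm (f (s *\<^sub>R x) - f (s *\<^sub>R y))" by (intro low) (simp add: sn)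
      then have "c * (7 * \<omega>) \<le> norm (g x - g y)" unfolding gn using c by (intro mult_left_mono) auto
      then show ?thesis using c(2) by (simp add: mult.left_commute)
    qed
    have "0 < \<epsilon> / s" using pos s by simp
    from threshold_map_of_coarse_lipschitz[OF M(2,1) this K\<tau> up lo] show ?thesis by blast
  qed
  then show ?thesis unfolding threshold_embeds_l2_def using K0 by blast
qed

section \<open>The space \<open>l2\<close> as an inner product space\<close>

text \<open>The martingale estimates are stated for the class \<open>real_inner\<close>; this type
  brings maps into \<open>l2_space\<close> under it.\<close>

typedef 'i ell2 = "l2_space :: ('i \<Rightarrow> real) set"
  morphisms ell2_nth ell2_of
  by (intro exI[of _ "\<lambda>_. 0"]) (simp add: l2_space_def)

lemma ell2_nth_summable: "(\<lambda>i. (ell2_nth x i)\<^sup>2) summable_on UNIV"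
  using ell2_nth[of x] by (simp add: l2_space_def)

lemma ell2_mult_summable: "(\<lambda>i. ell2_nth x i * ell2_nth y i) summable_on UNIV"
  by (rule square_summable_mult[OF ell2_nth_summable ell2_nth_summable])

lemma l2_space_scale: "f \<in> l2_space \<Longrightarrow> (\<lambda>i. c * f i) \<in> l2_space"
  unfolding l2_space_def by (simp add: power_mult_distrib summable_on_cmult_right)

lemma l2_space_add:
  assumes "f \<in> l2_space" "g \<in> l2_space"
  shows "(\<lambda>i. f i + g i) \<in> l2_space"
proof -
  have "(\<lambda>i. (f i)\<^sup>2 + (g i)\<^sup>2 + 2 * (f i * g i)) summable_on UNIV"
    using assms square_summable_mult[of f UNIV g] unfolding l2_space_def mem_Collect_eq
    by (intro summable_on_add summable_on_cmult_right)
  then show ?thesis by (simp add: l2_space_def power2_sum mult.assoc)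
qed

instantiation ell2 :: (type) real_vector
begin

definition "0 = ell2_of (\<lambda>_. 0)"
definition "x + y = ell2_of (\<lambda>i. ell2_nth x i + ell2_nth y i)"
definition "- x = ell2_of (\<lambda>i. - ell2_nth x i)"
definition "x - y = ell2_of (\<lambda>i. ell2_nth x i - ell2_nth y i)"
definition "c *\<^sub>R x = ell2_of (\<lambda>i. c * ell2_nth x i)"

lemma ell2_nth_zero: "ell2_nth 0 i = 0"
  by (simp add: zero_ell2_def ell2_of_inverse l2_space_def)

lemma ell2_nth_add: "ell2_nth (x + y) i = ell2_nth x i + ell2_nth y i"
  by (simp add: plus_ell2_def ell2_of_inverse l2_space_add ell2_nth)

lemma ell2_nth_scaleR: "ell2_nth (c *\<^sub>R x) i = c * ell2_nth x i"
  by (simp add: scaleR_ell2_def ell2_of_inverse l2_space_scale ell2_nth)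

lemma ell2_nth_uminus: "ell2_nth (- x) i = - ell2_nth x i"
  using l2_space_scale[OF ell2_nth, of "-1" x] by (simp add: uminus_ell2_def ell2_of_inverse)

lemma ell2_nth_minus: "ell2_nth (x - y) i = ell2_nth x i - ell2_nth y i"
  using l2_space_add[OF ell2_nth l2_space_scale[OF ell2_nth], of x "-1" y]
  by (simp add: minus_ell2_def ell2_of_inverse)

lemmas ell2_nth_simps = ell2_nth_zero ell2_nth_add ell2_nth_scaleR ell2_nth_uminus ell2_nth_minus

lemma ell2_eqI: "(\<And>i. ell2_nth x i = ell2_nth y i) \<Longrightarrow> x = y"
  by (metis ell2_nth_inject ext)

instance
  by standard (rule ell2_eqI, simp add: ell2_nth_simps algebra_simps)+

end

instantiation ell2 :: (type) real_inner
begin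

definition "x \<bullet> y = (\<Sum>\<^sub>\<infinity>i. ell2_nth x i * ell2_nth y i)"
definition "norm (x :: 'a ell2) = sqrt (x \<bullet> x)"
definition "dist (x :: 'a ell2) y = norm (x - y)"
definition "sgn (x :: 'a ell2) = x /\<^sub>R norm x"
definition "uniformity = (INF e\<in>{0 <..}. principal {(x :: 'a ell2, y). dist x y < e})"
definition "open (U :: 'a ell2 set) \<longleftrightarrow> (\<forall>x\<in>U. eventually (\<lambda>(x', y). x' = x \<longrightarrow> y \<in> U) uniformity)"

instance
proof
  fix x y z :: "'a ell2" and a b :: real
  show "dist x y = norm (x - y)" by (rule dist_ell2_def)
  show "sgn x = x /\<^sub>R norm x" by (rule sgn_ell2_def)
  show "uniformity = (INF e\<in>{0 <..}. principal {(x :: 'a ell2, y). dist x y < e})" by (rule uniformity_ell2_def)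
  show "open U \<longleftrightarrow> (\<forall>x\<in>U. eventually (\<lambda>(x', y). x' = x \<longrightarrow> y \<in> U) uniformity)" for U :: "'a ell2 set"
    by (rule open_ell2_def)
  show "x \<bullet> y = y \<bullet> x" by (simp add: inner_ell2_def mult.commute)
  show "(x + y) \<bullet> z = x \<bullet> z + y \<bullet> z"
    unfolding inner_ell2_def ell2_nth_simps distrib_right by (rule infsum_add[OF ell2_mult_summable ell2_mult_summable])
  show "a *\<^sub>R x \<bullet> y = a * (x \<bullet> y)"
    unfolding inner_ell2_def ell2_nth_simps mult.assoc by (rule infsum_cmult_right[OF ell2_mult_summable])
  show "0 \<le> x \<bullet> x" unfolding inner_ell2_def by (rule infsum_nonneg) simp
  show "x \<bullet> x = 0 \<longleftrightarrow> x = 0"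
  proof
    assume 0: "x \<bullet> x = 0"
    have "ell2_nth x i = 0" for i
    proof -
      have "(\<Sum>j\<in>{i}. ell2_nth x j * ell2_nth x j) \<le> x \<bullet> x"
        unfolding inner_ell2_def by (rule finite_sum_le_infsum[OF ell2_mult_summable]) auto
      then show ?thesis using 0 by (auto simp: mult_le_0_iff)
    qed
    then show "x = 0" by (intro ell2_eqI) (simp add: ell2_nth_simps)
  qed (simp add: inner_ell2_def ell2_nth_simps)
  show "norm x = sqrt (x \<bullet> x)" by (rule norm_ell2_def)
qed

end

lemma norm_ell2_of_diff:
  assumes "f \<in> l2_space" "g \<in> l2_space"
  shows "norm (ell2_of f - ell2_of g) = l2_dist f g"
  using assms by (simp add: norm_ell2_def inner_ell2_def ell2_nth_minus ell2_of_inverse l2_dist_def power2_eq_square)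

section \<open>Path expectations\<close>

text \<open>Trajectories are lists with the latest state first.\<close>

definition paths :: "nat \<Rightarrow> nat \<Rightarrow> nat list set" where
  "paths n t = {l. set l \<subseteq> {..<n} \<and> length l = Suc t}"

fun path_weight :: "(nat \<Rightarrow> nat \<Rightarrow> real) \<Rightarrow> nat list \<Rightarrow> real" where
  "path_weight P (j # i # l) = P i j * path_weight P (i # l)"
| "path_weight P _ = 1"

text \<open>The initial state is the last entry of the list, hence the weight
  \<open>w (last l)\<close>.\<close>

definition path_expectation ::
  "nat \<Rightarrow> (nat \<Rightarrow> real) \<Rightarrow> (nat \<Rightarrow> nat \<Rightarrow> real) \<Rightarrow> nat \<Rightarrow> (nat list \<Rightarrow> real) \<Rightarrow> real" where
  "path_expectation n w P t F = (\<Sum>l\<in>paths n t. w (last l) * path_weight P l * F l)"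

fun step_sum :: "(nat \<Rightarrow> nat \<Rightarrow> 'b::comm_monoid_add) \<Rightarrow> nat list \<Rightarrow> 'b" where
  "step_sum h (j # i # l) = step_sum h (i # l) + h i j"
| "step_sum h _ = 0"

lemma paths_0: "paths n 0 = (\<lambda>i. [i]) ` {..<n}"
  unfolding paths_def by (auto simp: length_Suc_conv)

lemma paths_Suc: "paths n (Suc t) = (\<lambda>(j, l). j # l) ` ({..<n} \<times> paths n t)"
proof
  show "paths n (Suc t) \<subseteq> (\<lambda>(j, l). j # l) ` ({..<n} \<times> paths n t)"
  proof
    fix l assume l: "l \<in> paths n (Suc t)"
    then obtain j l' where "l = j # l'" by (cases l) (auto simp: paths_def)
    then show "l \<in> (\<lambda>(j, l). j # l) ` ({..<n} \<times> paths n t)" using l by (force simp: paths_def)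
  qed
qed (auto simp: paths_def)

lemma paths_nonempty: "l \<in> paths n t \<Longrightarrow> l \<noteq> []"
  by (auto simp: paths_def)

lemma paths_hd_last: "l \<in> paths n t \<Longrightarrow> hd l < n \<and> last l < n"
  using paths_nonempty[of l n t] hd_in_set[of l] last_in_set[of l] unfolding paths_def by blast

lemma paths_induct [consumes 2, case_names single step]:
  assumes "set l \<subseteq> {..<n}" "l \<noteq> []"
    and "\<And>i. i < n \<Longrightarrow> Q [i]"
    and "\<And>i j l. i < n \<Longrightarrow> j < n \<Longrightarrow> set l \<subseteq> {..<n} \<Longrightarrow> Q (i # l) \<Longrightarrow> Q (j # i # l)"
  shows "Q l"
  using assms(1,2)
proof (induction l)
  case (Cons j l)
  then show ?case using assms(3,4) by (cases l) auto
qed simp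

lemma path_weight_append: "path_weight P (l @ [i, j]) = path_weight P (l @ [i]) * P j i"
proof (induction l)
  case (Cons a l)
  then show ?case by (cases l) auto
qed simp

lemma step_sum_append: "step_sum h (l @ [i, j]) = step_sum h (l @ [i]) + h j i"
proof (induction l)
  case (Cons a l)
  then show ?case by (cases l) (auto simp: ac_simps)
qed simp

lemma step_sum_rev: "step_sum h (rev l) = step_sum (\<lambda>i j. h j i) l"
proof (induction "\<lambda>i j. h j i" l rule: step_sum.induct)
  case (1 j i l)
  have "step_sum h (rev (j # i # l)) = step_sum h (rev l @ [i, j])" by simp
  also have "\<dots> = step_sum h (rev (i # l)) + h j i" by (subst step_sum_append) simp
  finally show ?case using 1 by simp
qed auto

context
  fixes n w P
  assumes chain: "rev_markov_chain n w P"
begin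

abbreviation "\<E> \<equiv> path_expectation n w P"

lemma path_weight_nonneg: "set l \<subseteq> {..<n} \<Longrightarrow> 0 \<le> path_weight P l"
  using rev_markov_chainD(3)[OF chain] by (induction P l rule: path_weight.induct) auto

text \<open>Detailed balance carries the stationary weight across one transition at a time.\<close>

lemma path_weight_rev:
  assumes "set l \<subseteq> {..<n}" "l \<noteq> []"
  shows "w (last l) * path_weight P l = w (hd l) * path_weight P (rev l)"
  using assms
proof (induction rule: paths_induct)
  case (step i j l)
  have "w (last (j # i # l)) * path_weight P (j # i # l) = P i j * (w (last (i # l)) * path_weight P (i # l))"
    by simp
  also have "\<dots> = (w i * P i j) * path_weight P (rev (i # l))" using step by simp
  also have "\<dots> = (w j * P j i) * path_weight P (rev l @ [i])" using rev_markov_chainD(5)[OF chain] step by simp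
  also have "\<dots> = w j * path_weight P (rev l @ [i, j])" by (simp add: path_weight_append)
  finally show ?case by simp
qed simp

lemma path_expectation_0: "\<E> 0 F = (\<Sum>i<n. w i * F [i])"
  unfolding path_expectation_def paths_0 by (subst sum.reindex) (auto simp: inj_on_def)

lemma path_expectation_Suc: "\<E> (Suc t) F = \<E> t (\<lambda>l. \<Sum>j<n. P (hd l) j * F (j # l))"
proof -
  have "\<E> (Suc t) F = (\<Sum>(j, l)\<in>{..<n} \<times> paths n t. w (last (j # l)) * path_weight P (j # l) * F (j # l))"
    unfolding path_expectation_def paths_Suc by (subst sum.reindex) (auto simp: inj_on_def case_prod_unfold)
  also have "\<dots> = (\<Sum>l\<in>paths n t. \<Sum>j<n. w (last (j # l)) * path_weight P (j # l) * F (j # l))"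
    by (subst sum.swap) (simp add: sum.cartesian_product)
  also have "\<dots> = (\<Sum>l\<in>paths n t. w (last l) * path_weight P l * (\<Sum>j<n. P (hd l) j * F (j # l)))"
  proof (rule sum.cong[OF refl])
    fix l assume "l \<in> paths n t"
    then obtain i l' where l: "l = i # l'" using paths_nonempty by (cases l) auto
    show "(\<Sum>j<n. w (last (j # l)) * path_weight P (j # l) * F (j # l)) =
        w (last l) * path_weight P l * (\<Sum>j<n. P (hd l) j * F (j # l))"
      unfolding sum_distrib_left by (intro sum.cong refl) (simp add: l)
  qed
  finally show ?thesis unfolding path_expectation_def .
qed

lemma path_expectation_mono:
  assumes "\<And>l. l \<in> paths n t \<Longrightarrow> F l \<le> G l"
  shows "\<E> t F \<le> \<E> t G"
  unfolding path_expectation_def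
proof (intro sum_mono mult_left_mono)
  fix l assume l: "l \<in> paths n t"
  show "F l \<le> G l" using assms l .
  show "0 \<le> w (last l) * path_weight P l"
    using rev_markov_chainD(1)[OF chain] paths_hd_last[OF l] path_weight_nonneg l
    by (auto simp: paths_def)
qed

lemma path_expectation_cong:
  assumes "\<And>l. l \<in> paths n t \<Longrightarrow> F l = G l"
  shows "\<E> t F = \<E> t G"
  unfolding path_expectation_def using assms by (intro sum.cong) auto

lemma path_expectation_add: "\<E> t (\<lambda>l. F l + G l) = \<E> t F + \<E> t G"
  by (simp add: path_expectation_def distrib_left sum.distrib)

lemma path_expectation_cmult: "\<E> t (\<lambda>l. c * F l) = c * \<E> t F"
  by (simp add: path_expectation_def sum_distrib_left mult_ac)

lemma path_expectation_sum: "\<E> t (\<lambda>l. \<Sum>k\<in>A. F k l) = (\<Sum>k\<in>A. \<E> t (F k))"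
  unfolding path_expectation_def sum_distrib_left by (rule sum.swap)

text \<open>Thanks to this symmetry one moment bound serves both the forward and the backward
  martingale.\<close>

lemma path_expectation_rev: "\<E> t (\<lambda>l. F (rev l)) = \<E> t F"
proof -
  have "\<E> t (\<lambda>l. F (rev l)) = (\<Sum>l\<in>rev ` paths n t. w (last (rev l)) * path_weight P (rev l) * F l)"
    unfolding path_expectation_def by (subst sum.reindex) auto
  also have "rev ` paths n t = paths n t"
  proof
    show "paths n t \<subseteq> rev ` paths n t"
    proof
      fix l assume "l \<in> paths n t"
      then show "l \<in> rev ` paths n t" by (intro image_eqI[of _ _ "rev l"]) (auto simp: paths_def)
    qed
  qed (auto simp: paths_def)
  also have "(\<Sum>l\<in>paths n t. w (last (rev l)) * path_weight P (rev l) * F l) =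
      (\<Sum>l\<in>paths n t. w (last l) * path_weight P l * F l)"
  proof (rule sum.cong[OF refl])
    fix l assume l: "l \<in> paths n t"
    then have "w (last l) * path_weight P l = w (hd l) * path_weight P (rev l)"
      by (intro path_weight_rev) (auto simp: paths_def)
    then show "w (last (rev l)) * path_weight P (rev l) * F l = w (last l) * path_weight P l * F l"
      using paths_nonempty[OF l] by (simp add: last_rev)
  qed
  finally show ?thesis unfolding path_expectation_def .
qed

lemma path_expectation_endpoints:
  "\<E> t (\<lambda>l. h (last l) (hd l)) = (\<Sum>i<n. \<Sum>j<n. w i * mat_pow n P t i j * h i j)"
proof (induction t arbitrary: h)
  case 0
  have "(\<Sum>j<n. w i * mat_pow n P 0 i j * h i j) = w i * h i i" if "i < n" for i
  proof -
    have "(\<Sum>j<n. w i * mat_pow n P 0 i j * h i j) = (\<Sum>j<n. if j = i then w i * h i j else 0)"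
      by (intro sum.cong) auto
    then show ?thesis using that by simp
  qed
  then show ?case by (simp add: path_expectation_0)
next
  case (Suc t)
  have "\<E> (Suc t) (\<lambda>l. h (last l) (hd l)) = \<E> t (\<lambda>l. \<Sum>j<n. P (hd l) j * h (last l) j)"
    unfolding path_expectation_Suc by (intro path_expectation_cong sum.cong refl) (simp add: paths_nonempty)
  also have "\<dots> = (\<Sum>i<n. \<Sum>k<n. w i * mat_pow n P t i k * (\<Sum>j<n. P k j * h i j))"
    by (rule Suc)
  also have "\<dots> = (\<Sum>i<n. \<Sum>j<n. w i * mat_pow n P (Suc t) i j * h i j)"
  proof (rule sum.cong[OF refl])
    fix i
    show "(\<Sum>k<n. w i * mat_pow n P t i k * (\<Sum>j<n. P k j * h i j)) = (\<Sum>j<n. w i * mat_pow n P (Suc t) i j * h i j)"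
      unfolding mat_pow.simps sum_distrib_left sum_distrib_right by (subst sum.swap) (simp add: mult_ac)
  qed
  finally show ?case .
qed

lemma path_expectation_hd: "\<E> t (\<lambda>l. h (hd l)) = (\<Sum>i<n. w i * h i)"
proof -
  have "\<E> t (\<lambda>l. h (hd l)) = (\<Sum>j<n. (\<Sum>i<n. w i * mat_pow n P t i j) * h j)"
    unfolding path_expectation_endpoints[of t "\<lambda>_. h"] sum_distrib_right by (rule sum.swap)
  also have "\<dots> = (\<Sum>j<n. w j * h j)"
    using rev_markov_chainD(6)[OF rev_markov_chain_mat_pow[OF chain]] by (intro sum.cong) auto
  finally show ?thesis .
qed

lemma stationary_sum: "(\<Sum>i<n. \<Sum>j<n. w i * P i j * h j) = (\<Sum>j<n. w j * h j)"
proof -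
  have "(\<Sum>i<n. \<Sum>j<n. w i * P i j * h j) = (\<Sum>j<n. (\<Sum>i<n. w i * P i j) * h j)"
    unfolding sum_distrib_right by (rule sum.swap)
  then show ?thesis using rev_markov_chainD(6)[OF chain] by simp
qed

lemma path_expectation_Suc_split:
  assumes "\<And>l j. l \<in> paths n t \<Longrightarrow> j < n \<Longrightarrow> F (j # l) = F l + h (hd l) j"
  shows "\<E> (Suc t) F = \<E> t F + (\<Sum>i<n. \<Sum>j<n. w i * P i j * h i j)"
proof -
  have "\<E> (Suc t) F = \<E> t (\<lambda>l. F l + (\<Sum>j<n. P (hd l) j * h (hd l) j))"
    unfolding path_expectation_Suc
  proof (rule path_expectation_cong)
    fix l assume l: "l \<in> paths n t"
    have "(\<Sum>j<n. P (hd l) j * F (j # l)) = (\<Sum>j<n. P (hd l) j) * F l + (\<Sum>j<n. P (hd l) j * h (hd l) j)"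
      using assms[OF l] by (simp add: distrib_left sum.distrib sum_distrib_right)
    then show "(\<Sum>j<n. P (hd l) j * F (j # l)) = F l + (\<Sum>j<n. P (hd l) j * h (hd l) j)"
      using rev_markov_chainD(4)[OF chain] paths_hd_last[OF l] by simp
  qed
  also have "\<dots> = \<E> t F + (\<Sum>i<n. w i * (\<Sum>j<n. P i j * h i j))"
    unfolding path_expectation_add using path_expectation_hd[of t "\<lambda>i. \<Sum>j<n. P i j * h i j"] by simp
  finally show ?thesis by (simp add: sum_distrib_left mult.assoc)
qed

lemma path_expectation_step_sum:
  "\<E> t (step_sum h) = real t * (\<Sum>i<n. \<Sum>j<n. w i * P i j * h i j)"
proof (induction t)
  case (Suc t)
  have "\<E> (Suc t) (step_sum h) = \<E> t (step_sum h) + (\<Sum>i<n. \<Sum>j<n. w i * P i j * h i j)"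
  proof (rule path_expectation_Suc_split)
    fix l j assume "l \<in> paths n t"
    then show "step_sum h (j # l) = step_sum h l + h (hd l) j"
      using paths_nonempty by (cases l) auto
  qed
  then show ?case using Suc by (simp add: distrib_right)
qed (simp add: path_expectation_0)

lemma path_expectation_sum_list:
  "\<E> t (\<lambda>l. sum_list (map v l)) = real (Suc t) * (\<Sum>i<n. w i * v i)"
proof (induction t)
  case (Suc t)
  have "\<E> (Suc t) (\<lambda>l. sum_list (map v l)) = \<E> t (\<lambda>l. sum_list (map v l)) + (\<Sum>i<n. \<Sum>j<n. w i * P i j * v j)"
    by (rule path_expectation_Suc_split) simp
  then show ?case using Suc by (simp add: stationary_sum distrib_right)
qed (simp add: path_expectation_0)

end

section \<open>Stopped martingales along a chain\<close>

text \<open>The term linear in \<open>y\<close> is kept exact because it averages to 0 over a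
  martingale increment. The cross term \<open>4 c b^2\<close> is absorbed by the square
  \<open>2 (c - b^2)^2\<close>, which raises the last two coefficients to 8 and 3.\<close>

lemma norm_add_power4_le:
  fixes x y :: "'h::real_inner"
  shows "(norm (x + y))^4 \<le> (norm x)^4 + 4 * (norm x)\<^sup>2 * (x \<bullet> y) + 8 * (norm x)\<^sup>2 * (norm y)\<^sup>2 + 3 * (norm y)^4"
proof -
  define a b c where "a = norm x" and "b = norm y" and "c = x \<bullet> y"
  have "(norm (x + y))\<^sup>2 = a\<^sup>2 + 2 * c + b\<^sup>2"
    by (simp add: a_def b_def c_def power2_norm_eq_inner inner_add_left inner_add_right inner_commute)
  then have "(norm (x + y))^4 = (a\<^sup>2 + 2 * c + b\<^sup>2)\<^sup>2"
    by (simp add: power4_eq_xxxx power2_eq_square)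
  also have "\<dots> = a^4 + 4 * a\<^sup>2 * c + 2 * a\<^sup>2 * b\<^sup>2 + 4 * c\<^sup>2 + 4 * c * b\<^sup>2 + b^4" by algebra
  finally have eq: "(norm (x + y))^4 = a^4 + 4 * a\<^sup>2 * c + 2 * a\<^sup>2 * b\<^sup>2 + 4 * c\<^sup>2 + 4 * c * b\<^sup>2 + b^4" .
  have "\<bar>c\<bar> \<le> a * b" unfolding a_def b_def c_def by (rule Cauchy_Schwarz_ineq2)
  then have "\<bar>c\<bar>\<^sup>2 \<le> (a * b)\<^sup>2" by (intro power_mono) auto
  then have c2: "c\<^sup>2 \<le> a\<^sup>2 * b\<^sup>2" by (simp add: power_mult_distrib)
  have "0 \<le> 2 * (c - b\<^sup>2)\<^sup>2" by simp
  also have "\<dots> = 2 * c\<^sup>2 - 4 * c * b\<^sup>2 + 2 * b^4" by algebra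
  finally have "4 * c * b\<^sup>2 \<le> 2 * c\<^sup>2 + 2 * b^4" by linarith
  then show ?thesis using eq c2 unfolding a_def[symmetric] b_def[symmetric] c_def[symmetric] by linarith
qed

text \<open>The admission test reads the path up to the current state \<open>i\<close>, before
  \<open>j\<close> is drawn, so centred increments keep their martingale property.\<close>

fun stopped_sum :: "(nat list \<Rightarrow> bool) \<Rightarrow> (nat \<Rightarrow> nat \<Rightarrow> 'b::comm_monoid_add) \<Rightarrow> nat list \<Rightarrow> 'b" where
  "stopped_sum p h (j # i # l) = stopped_sum p h (i # l) + (if p (i # l) then h i j else 0)"
| "stopped_sum p h _ = 0"

text \<open>A Burkholder-type bound: compensating the fourth power by \<open>8 |x|\<^sup>2\<close> times the predictable
  quadratic variation leaves only the fourth moments of the increments.\<close>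

lemma stopped_martingale_compensated:
  fixes \<xi> :: "nat \<Rightarrow> nat \<Rightarrow> 'h::real_inner"
  assumes chain: "rev_markov_chain n w P"
    and mean: "\<And>i. i < n \<Longrightarrow> (\<Sum>j<n. P i j *\<^sub>R \<xi> i j) = 0"
    and var: "\<And>i. i < n \<Longrightarrow> (\<Sum>j<n. P i j * (norm (\<xi> i j))\<^sup>2) \<le> v i"
  shows "path_expectation n w P t (\<lambda>l. (norm (stopped_sum p \<xi> l))^4 - 8 * (norm (stopped_sum p \<xi> l))\<^sup>2 * stopped_sum p (\<lambda>i j. v i) l)
     \<le> 3 * (real t * (\<Sum>i<n. \<Sum>j<n. w i * P i j * (norm (\<xi> i j))^4))"
proof (induction t)
  case 0
  then show ?case by (simp add: path_expectation_0[OF chain])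
next
  case (Suc t)
  note P = rev_markov_chainD[OF chain]
  define x where "x = stopped_sum p \<xi>"
  define B where "B = stopped_sum p (\<lambda>i j. v i)"
  define q where "q i = (\<Sum>j<n. P i j * (norm (\<xi> i j))^4)" for i
  have v0: "0 \<le> v i" if "i < n" for i
  proof -
    have "0 \<le> (\<Sum>j<n. P i j * (norm (\<xi> i j))\<^sup>2)" using P(3)[OF that] by (intro sum_nonneg) auto
    then show ?thesis using var[OF that] by linarith
  qed
  have B0: "0 \<le> B l" if "set l \<subseteq> {..<n}" for l
    unfolding B_def using that v0 by (induction l rule: induct_list012) auto
  have one: "(\<Sum>j<n. P (hd l) j * ((norm (x (j # l)))^4 - 8 * (norm (x (j # l)))\<^sup>2 * B (j # l)))
      \<le> ((norm (x l))^4 - 8 * (norm (x l))\<^sup>2 * B l) + 3 * q (hd l)" if l: "l \<in> paths n t" for l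
  proof -
    obtain i l' where li: "l = i # l'" using paths_nonempty[OF l] by (cases l) auto
    have i: "i < n" using l by (simp add: li paths_def)
    have q0: "0 \<le> q i" unfolding q_def using P(3)[OF i] by (intro sum_nonneg) auto
    have Bl: "0 \<le> B l" using B0 l by (simp add: paths_def)
    show ?thesis
    proof (cases "p l")
      case False
      then have "x (j # l) = x l" "B (j # l) = B l" for j by (simp_all add: x_def B_def li)
      then show ?thesis using q0 P(4)[OF i] by (simp add: li sum_distrib_right[symmetric])
    next
      case True
      then have xj: "x (j # l) = x l + \<xi> i j" and Bj: "B (j # l) = B l + v i" for j
        by (simp_all add: x_def B_def li)
      define s where "s = (\<Sum>j<n. P i j * (norm (\<xi> i j))\<^sup>2)"
      have s: "0 \<le> s" "s \<le> v i" unfolding s_def using P(3)[OF i] var[OF i] by (auto intro!: sum_nonneg)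
      have lin: "(\<Sum>j<n. P i j * (x l \<bullet> \<xi> i j)) = 0"
      proof -
        have "(\<Sum>j<n. P i j * (x l \<bullet> \<xi> i j)) = x l \<bullet> (\<Sum>j<n. P i j *\<^sub>R \<xi> i j)" by (simp add: inner_sum_right)
        then show ?thesis using mean[OF i] by simp
      qed
      have four: "(\<Sum>j<n. P i j * (norm (x l + \<xi> i j))^4) \<le> (norm (x l))^4 + 8 * (norm (x l))\<^sup>2 * s + 3 * q i"
      proof -
        have "(\<Sum>j<n. P i j * (norm (x l + \<xi> i j))^4) \<le>
          (\<Sum>j<n. P i j * ((norm (x l))^4 + 4 * (norm (x l))\<^sup>2 * (x l \<bullet> \<xi> i j) + 8 * (norm (x l))\<^sup>2 * (norm (\<xi> i j))\<^sup>2 + 3 * (norm (\<xi> i j))^4))"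
          using P(3)[OF i] by (intro sum_mono mult_left_mono norm_add_power4_le) auto
        also have "\<dots> = (\<Sum>j<n. P i j) * (norm (x l))^4 + 4 * (norm (x l))\<^sup>2 * (\<Sum>j<n. P i j * (x l \<bullet> \<xi> i j))
            + 8 * (norm (x l))\<^sup>2 * s + 3 * q i"
          unfolding s_def q_def by (simp add: sum_distrib_left sum_distrib_right sum.distrib distrib_left mult_ac)
        finally show ?thesis using lin P(4)[OF i] by simp
      qed
      have two: "(\<Sum>j<n. P i j * (norm (x l + \<xi> i j))\<^sup>2) = (norm (x l))\<^sup>2 + s"
      proof -
        have "(\<Sum>j<n. P i j * (norm (x l + \<xi> i j))\<^sup>2) =
          (\<Sum>j<n. P i j * ((norm (x l))\<^sup>2 + 2 * (x l \<bullet> \<xi> i j) + (norm (\<xi> i j))\<^sup>2))"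
          by (intro sum.cong refl) (simp add: power2_norm_eq_inner inner_add_left inner_add_right inner_commute)
        also have "\<dots> = (\<Sum>j<n. P i j) * (norm (x l))\<^sup>2 + 2 * (\<Sum>j<n. P i j * (x l \<bullet> \<xi> i j)) + s"
          unfolding s_def by (simp add: sum_distrib_left sum_distrib_right sum.distrib distrib_left mult_ac)
        finally show ?thesis using lin P(4)[OF i] by simp
      qed
      have "(\<Sum>j<n. P (hd l) j * ((norm (x (j # l)))^4 - 8 * (norm (x (j # l)))\<^sup>2 * B (j # l)))
         = (\<Sum>j<n. P i j * (norm (x l + \<xi> i j))^4) - 8 * (B l + v i) * (\<Sum>j<n. P i j * (norm (x l + \<xi> i j))\<^sup>2)"
        unfolding xj Bj sum_distrib_left sum_subtractf[symmetric]
        by (intro sum.cong refl) (simp add: li algebra_simps)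
      also have "\<dots> \<le> (norm (x l))^4 + 8 * (norm (x l))\<^sup>2 * s + 3 * q i - 8 * (B l + v i) * ((norm (x l))\<^sup>2 + s)"
        unfolding two using four by simp
      \<comment> \<open>The compensator grows by \<open>8 |x|^2 v i\<close>, which outweighs the
        gain \<open>8 |x|^2 s\<close> because \<open>s\<close> is at most
        \<open>v i\<close>.\<close>
      also have "\<dots> = (norm (x l))^4 - 8 * (norm (x l))\<^sup>2 * B l + 3 * q i
          - 8 * ((norm (x l))\<^sup>2 * (v i - s)) - 8 * ((B l + v i) * s)"
        by (simp add: algebra_simps)
      also have "\<dots> \<le> (norm (x l))^4 - 8 * (norm (x l))\<^sup>2 * B l + 3 * q i"
      proof -
        have "0 \<le> (norm (x l))\<^sup>2 * (v i - s)" "0 \<le> (B l + v i) * s" using s Bl by auto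
        then show ?thesis by linarith
      qed
      finally show ?thesis by (simp add: li)
    qed
  qed
  have "path_expectation n w P (Suc t) (\<lambda>l. (norm (x l))^4 - 8 * (norm (x l))\<^sup>2 * B l)
    \<le> path_expectation n w P t (\<lambda>l. ((norm (x l))^4 - 8 * (norm (x l))\<^sup>2 * B l) + 3 * q (hd l))"
    unfolding path_expectation_Suc[OF chain] by (intro path_expectation_mono[OF chain] one)
  also have "\<dots> = path_expectation n w P t (\<lambda>l. (norm (x l))^4 - 8 * (norm (x l))\<^sup>2 * B l) + 3 * (\<Sum>i<n. w i * q i)"
    unfolding path_expectation_add[OF chain] path_expectation_cmult[OF chain] path_expectation_hd[OF chain] by simp
  also have "(\<Sum>i<n. w i * q i) = (\<Sum>i<n. \<Sum>j<n. w i * P i j * (norm (\<xi> i j))^4)"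
    by (simp add: q_def sum_distrib_left mult.assoc)
  finally show ?case using Suc.IH unfolding x_def B_def by (simp add: algebra_simps)
qed

text \<open>Nonnegativity of the square of \<open>|x|^2 - 8 B\<close> trades the mixed term of the
  compensated bound for \<open>64 B^2\<close>.\<close>

lemma stopped_martingale_fourth_moment:
  fixes \<xi> :: "nat \<Rightarrow> nat \<Rightarrow> 'h::real_inner"
  assumes chain: "rev_markov_chain n w P"
    and mean: "\<And>i. i < n \<Longrightarrow> (\<Sum>j<n. P i j *\<^sub>R \<xi> i j) = 0"
    and var: "\<And>i. i < n \<Longrightarrow> (\<Sum>j<n. P i j * (norm (\<xi> i j))\<^sup>2) \<le> v i"
  shows "path_expectation n w P t (\<lambda>l. (norm (stopped_sum p \<xi> l))^4)
     \<le> 64 * path_expectation n w P t (\<lambda>l. (stopped_sum p (\<lambda>i j. v i) l)\<^sup>2)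
       + 6 * (real t * (\<Sum>i<n. \<Sum>j<n. w i * P i j * (norm (\<xi> i j))^4))"
proof -
  let ?x = "\<lambda>l. norm (stopped_sum p \<xi> l)" and ?B = "stopped_sum p (\<lambda>i j. v i)"
  have pt: "(?x l)^4 \<le> 2 * ((?x l)^4 - 8 * (?x l)\<^sup>2 * ?B l) + 64 * (?B l)\<^sup>2" for l
  proof -
    have "0 \<le> ((?x l)\<^sup>2 - 8 * ?B l)\<^sup>2" by simp
    also have "\<dots> = (?x l)^4 - 16 * (?x l)\<^sup>2 * ?B l + 64 * (?B l)\<^sup>2"
      by (simp add: power4_eq_xxxx power2_eq_square algebra_simps)
    finally show ?thesis by (simp add: algebra_simps)
  qed
  have "path_expectation n w P t (\<lambda>l. (?x l)^4) \<le>
      path_expectation n w P t (\<lambda>l. 2 * ((?x l)^4 - 8 * (?x l)\<^sup>2 * ?B l) + 64 * (?B l)\<^sup>2)"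
    by (intro path_expectation_mono[OF chain] pt)
  also have "\<dots> = 2 * path_expectation n w P t (\<lambda>l. (?x l)^4 - 8 * (?x l)\<^sup>2 * ?B l) + 64 * path_expectation n w P t (\<lambda>l. (?B l)\<^sup>2)"
    by (simp only: path_expectation_add[OF chain] path_expectation_cmult[OF chain])
  finally show ?thesis using stopped_martingale_compensated[OF chain mean var, of t p] by linarith
qed

section \<open>Markov type 2 from threshold maps\<close>

lemma norm_sum_power4_le:
  fixes a :: "nat \<Rightarrow> 'h::real_inner"
  assumes p: "\<And>j. j < n \<Longrightarrow> 0 \<le> p j" "(\<Sum>j<n. p j) = (1::real)"
  shows "(norm (\<Sum>j<n. p j *\<^sub>R a j))^4 \<le> (\<Sum>j<n. p j * (norm (a j))^4)"
proof -
  have "(norm (\<Sum>j<n. p j *\<^sub>R a j))\<^sup>2 \<le> (\<Sum>j<n. p j * (norm (a j))\<^sup>2)"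
    using p by (intro norm_sum_square_le) auto
  then have "((norm (\<Sum>j<n. p j *\<^sub>R a j))\<^sup>2)\<^sup>2 \<le> (\<Sum>j<n. p j * (norm (a j))\<^sup>2)\<^sup>2"
    by (intro power_mono) auto
  also have "\<dots> = (norm (\<Sum>j<n. p j *\<^sub>R ((norm (a j))\<^sup>2)))\<^sup>2" by simp
  also have "\<dots> \<le> (\<Sum>j<n. p j * (norm ((norm (a j))\<^sup>2))\<^sup>2)"
    using p by (intro norm_sum_square_le) auto
  finally show ?thesis by (simp add: power4_eq_xxxx power2_eq_square mult.assoc)
qed

lemma sum_power4_le: "(a + b)^4 \<le> 8 * (a^4 + b^4)" for a b :: real
proof -
  have "(a + b)\<^sup>2 \<le> 2 * (a\<^sup>2 + b\<^sup>2)"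
    using zero_le_power2[of "a - b"] by (simp add: power2_eq_square algebra_simps)
  then have "((a + b)\<^sup>2)\<^sup>2 \<le> (2 * (a\<^sup>2 + b\<^sup>2))\<^sup>2" by (intro power_mono) auto
  also have "\<dots> \<le> 8 * (a^4 + b^4)"
    using zero_le_power2[of "a\<^sup>2 - b\<^sup>2"] by (simp add: power4_eq_xxxx power2_eq_square algebra_simps)
  finally show ?thesis by (simp add: power4_eq_xxxx power2_eq_square mult.assoc)
qed

lemma centered_fourth_moment:
  fixes a :: "nat \<Rightarrow> 'h::real_inner"
  assumes p: "\<And>j. j < n \<Longrightarrow> 0 \<le> p j" "(\<Sum>j<n. p j) = (1::real)"
  shows "(\<Sum>j<n. p j * (norm (a j - (\<Sum>k<n. p k *\<^sub>R a k)))^4) \<le> 16 * (\<Sum>j<n. p j * (norm (a j))^4)"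
proof -
  define m where "m = (\<Sum>k<n. p k *\<^sub>R a k)"
  have "(norm (a j - m))^4 \<le> 8 * ((norm (a j))^4 + (norm m)^4)" for j
    by (rule order_trans[OF power_mono[OF norm_triangle_ineq4[of "a j" m] norm_ge_zero] sum_power4_le])
  then have "(\<Sum>j<n. p j * (norm (a j - m))^4) \<le> (\<Sum>j<n. p j * (8 * ((norm (a j))^4 + (norm m)^4)))"
    using p by (intro sum_mono mult_left_mono) auto
  also have "\<dots> = 8 * (\<Sum>j<n. p j * (norm (a j))^4) + 8 * ((\<Sum>j<n. p j) * (norm m)^4)"
    unfolding sum_distrib_left sum_distrib_right sum.distrib[symmetric]
    by (intro sum.cong refl) (simp add: algebra_simps)
  also have "\<dots> \<le> 16 * (\<Sum>j<n. p j * (norm (a j))^4)"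
    using norm_sum_power4_le[OF p, of a] p(2) by (simp add: m_def)
  finally show ?thesis by (simp add: m_def)
qed

lemma centered_second_moment:
  fixes a :: "nat \<Rightarrow> 'h::real_inner"
  assumes p: "(\<Sum>j<n. p j) = (1::real)"
  shows "(\<Sum>j<n. p j * (norm (a j - (\<Sum>k<n. p k *\<^sub>R a k)))\<^sup>2) \<le> (\<Sum>j<n. p j * (norm (a j))\<^sup>2)"
proof -
  define m where "m = (\<Sum>k<n. p k *\<^sub>R a k)"
  have "(\<Sum>j<n. p j * (norm (a j - m))\<^sup>2) = (\<Sum>j<n. p j * (norm (a j))\<^sup>2) - 2 * ((\<Sum>j<n. p j *\<^sub>R a j) \<bullet> m) + (\<Sum>j<n. p j) * (norm m)\<^sup>2"
    unfolding inner_sum_left sum_distrib_left sum_distrib_right sum_subtractf[symmetric] sum.distrib[symmetric]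
    by (intro sum.cong refl) (simp add: power2_norm_eq_inner inner_diff_left inner_diff_right inner_commute algebra_simps)
  also have "\<dots> = (\<Sum>j<n. p j * (norm (a j))\<^sup>2) - (norm m)\<^sup>2"
    using p by (simp add: m_def[symmetric] power2_norm_eq_inner)
  finally show ?thesis by (simp add: m_def)
qed

text \<open>\<open>a\<close> is a squared length: a squared step or a quadratic variation. For
  positive \<open>a\<close> the profile peaks at \<open>s^2 = a\<close> with value \<open>a\<close>
  and falls off geometrically on both sides along dyadic scales.\<close>

definition scale_profile :: "real \<Rightarrow> real \<Rightarrow> real" where
  "scale_profile s a = min (s\<^sup>2) (a\<^sup>2 / s\<^sup>2)"

text \<open>Telescoping against \<open>a q / (a + q)\<close> with \<open>q = s\<^sup>2\<close>.\<close>

lemma scale_profile_sum: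
  assumes r: "0 < r" and a: "0 \<le> a"
  shows "(\<Sum>k<N. scale_profile (r * 2 ^ k) a) \<le> 4 * a"
proof (cases "a = 0")
  case True
  then show ?thesis by (simp add: scale_profile_def)
next
  case False
  then have a: "0 < a" using a by simp
  define q where "q k = (r * 2 ^ k)\<^sup>2" for k :: nat
  \<comment> \<open>\<open>a q / (a + q)\<close> is comparable to \<open>min a q\<close>, so its
    increments along the scales concentrate near \<open>q = a\<close>. As \<open>q\<close>
    quadruples, the factor 4 gives an increment with numerator \<open>12 a^2 x\<close>, and 12
    exceeds the 10 that comes from bounding the denominator by
    \<open>10 (max a x)^2\<close>.\<close>
  define \<psi> where "\<psi> k = 4 * a * q k / (a + q k)" for k
  have q0: "0 < q k" and qS: "q (Suc k) = 4 * q k" for k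
    using r by (auto simp: q_def power_mult_distrib)
  have "scale_profile (r * 2 ^ k) a \<le> \<psi> (Suc k) - \<psi> k" for k
  proof -
    define x where "x = q k"
    have x: "0 < x" using q0 by (simp add: x_def)
    have "\<psi> (Suc k) - \<psi> k = 12 * a\<^sup>2 * x / ((a + 4 * x) * (a + x))"
      using a x unfolding \<psi>_def qS x_def[symmetric] by (simp add: divide_simps add_pos_pos) (simp add: algebra_simps power2_eq_square)
    moreover have "min x (a\<^sup>2 / x) \<le> 12 * a\<^sup>2 * x / ((a + 4 * x) * (a + x))"
    proof (cases "x \<le> a")
      case True
      have "(a + 4 * x) * (a + x) \<le> (5 * a) * (2 * a)" using True x a by (intro mult_mono) auto
      also have "\<dots> \<le> 5 * a * (2 * a) + 2 * a\<^sup>2" by simp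
      also have "\<dots> = 12 * a\<^sup>2" by (simp add: power2_eq_square)
      finally have "x * ((a + 4 * x) * (a + x)) \<le> x * (12 * a\<^sup>2)" using x by (intro mult_left_mono) auto
      then have "x \<le> 12 * a\<^sup>2 * x / ((a + 4 * x) * (a + x))"
        using a x by (simp add: pos_le_divide_eq mult.commute)
      then show ?thesis by simp
    next
      case False
      have "(a + 4 * x) * (a + x) \<le> (5 * x) * (2 * x)" using False x a by (intro mult_mono) auto
      also have "\<dots> \<le> 5 * x * (2 * x) + 2 * x\<^sup>2" by simp
      also have "\<dots> = 12 * x\<^sup>2" by (simp add: power2_eq_square)
      finally have "a\<^sup>2 * ((a + 4 * x) * (a + x)) \<le> a\<^sup>2 * (12 * x\<^sup>2)" by (intro mult_left_mono) auto
      then have "a\<^sup>2 / x \<le> 12 * a\<^sup>2 * x / ((a + 4 * x) * (a + x))"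
        using a x by (simp add: pos_le_divide_eq pos_divide_le_eq power2_eq_square mult_ac)
      then show ?thesis by simp
    qed
    ultimately show ?thesis by (simp add: scale_profile_def x_def q_def)
  qed
  then have "(\<Sum>k<N. scale_profile (r * 2 ^ k) a) \<le> (\<Sum>k<N. \<psi> (Suc k) - \<psi> k)" by (intro sum_mono)
  also have "\<dots> = \<psi> N - \<psi> 0" by (rule sum_lessThan_telescope)
  also have "\<dots> \<le> 4 * a"
  proof -
    have "0 \<le> \<psi> 0" using a q0[of 0] by (simp add: \<psi>_def)
    moreover have "\<psi> N \<le> 4 * a" using a q0[of N] by (simp add: \<psi>_def divide_simps add_pos_pos algebra_simps)
    ultimately show ?thesis by simp
  qed
  finally show ?thesis .
qed

section \<open>Stopping and truncation at a single scale\<close>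

text \<open>As \<open>v\<close> is nonnegative, all earlier partial sums are below the threshold
  too, so nothing was stopped.\<close>

lemma stopped_sum_eq_step_sum:
  fixes \<theta> :: real
  assumes "set l \<subseteq> {..<n}" "\<And>i. i < n \<Longrightarrow> 0 \<le> v i" "sum_list (map v l) < \<theta>"
  shows "stopped_sum (\<lambda>l. sum_list (map v l) < \<theta>) h l = step_sum h l"
  using assms(1,3)
proof (induction h l rule: step_sum.induct)
  case (1 h j i l)
  then have "sum_list (map v (i # l)) < \<theta>" using assms(2)[of j] by auto
  then show ?case using 1 by auto
qed auto

lemma stopped_sum_bounds:
  assumes "set l \<subseteq> {..<n}" "l \<noteq> []" "\<And>i. i < n \<Longrightarrow> (0::real) \<le> v i" "0 \<le> \<theta>"
  defines "S \<equiv> stopped_sum (\<lambda>l. sum_list (map v l) < \<theta>) (\<lambda>i j. v i)"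
  shows "0 \<le> S l \<and> S l \<le> sum_list (map v (tl l)) \<and> S l \<le> \<theta>"
  using assms(1,2)
proof (induction rule: paths_induct)
  case (step i j l)
  have "0 \<le> sum_list (map v l)" using step assms(3) by (intro sum_list_nonneg) auto
  then show ?case using step assms(3)[of i] by (auto simp: S_def)
qed (use assms(4) in \<open>simp add: S_def\<close>)

lemma step_sum_nonneg: "(\<And>i j. (0::real) \<le> h i j) \<Longrightarrow> 0 \<le> step_sum h l"
  by (induction l rule: induct_list012) auto

text \<open>A single bad step would bring the penalty up to \<open>c\<close>, so there is none and
  the increments telescope.\<close>

lemma step_sum_potential:
  fixes u :: "nat \<Rightarrow> 'h::real_vector" and c :: real
  assumes "step_sum (\<lambda>i j. if b i j then c else 0) l < c" "0 < c" "l \<noteq> []"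
  shows "step_sum (\<lambda>i j. if b i j then 0 else u j - u i) l = u (hd l) - u (last l)"
  using assms(1,3)
proof (induction l rule: induct_list012)
  case (3 j i l)
  have "0 \<le> step_sum (\<lambda>i j. if b i j then c else 0) (i # l)"
    using step_sum_nonneg[of "\<lambda>i j. if b i j then c else 0"] assms(2) by simp
  then have "\<not> b i j" "step_sum (\<lambda>i j. if b i j then c else 0) (i # l) < c"
    using 3(3) assms(2) by (auto split: if_splits)
  then show ?case using 3(2) by simp
qed auto

text \<open>Steps longer than \<open>s\<close> are discarded. By antisymmetry of the truncated increments \<open>a\<close>, twice
  their sum along a path is the difference of the forward and the time-reversed martingale, up to
  two boundary terms.\<close>

lemma single_scale_bound:
  fixes u :: "nat \<Rightarrow> 'h::real_inner" and d :: "nat \<Rightarrow> nat \<Rightarrow> real"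
  assumes chain: "rev_markov_chain n w P"
    and sym: "\<And>i j. d i j = d j i"
    and lip: "\<And>i j. i < n \<Longrightarrow> j < n \<Longrightarrow> norm (u i - u j) \<le> d i j" and s: "0 < s"
  defines "v \<equiv> \<lambda>i. \<Sum>j<n. P i j * (d i j)\<^sup>2"
  shows "(\<Sum>i<n. \<Sum>j<n. w i * mat_pow n P t i j * (if s \<le> norm (u i - u j) then s\<^sup>2 else 0))
    \<le> 3073 * (real t * (\<Sum>i<n. \<Sum>j<n. w i * P i j * scale_profile s ((d i j)\<^sup>2)))
      + 2064 * path_expectation n w P t (\<lambda>l. scale_profile s (sum_list (map v l)))"
proof -
  note C = rev_markov_chainD[OF chain]
  define a where "a i j = (if s < d i j then 0 else u j - u i)" for i j
  define m where "m i = (\<Sum>j<n. P i j *\<^sub>R a i j)" for i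
  define \<xi> where "\<xi> i j = a i j - m i" for i j
  define V where "V l = sum_list (map v l)" for l
  \<comment> \<open>On paths with \<open>V l < \<theta>\<close> each drift \<open>m i\<close> met
    has norm at most \<open>s / 2\<close>. The two boundary terms then take at most \<open>s\<close>
    from the doubled displacement, which is at least \<open>2 * s\<close>, and leave
    \<open>s\<close> for the two martingales.\<close>
  define \<theta> where "\<theta> = s\<^sup>2 / 4"
  define x where "x = stopped_sum (\<lambda>l. V l < \<theta>) \<xi>"
  define S where "S = stopped_sum (\<lambda>l. V l < \<theta>) (\<lambda>i j. v i)"
  define D where "D = step_sum (\<lambda>i j. if s < d i j then s\<^sup>2 else 0)"
  have v0: "0 \<le> v i" if "i < n" for i unfolding v_def using C(3)[OF that] by (intro sum_nonneg) auto
  have a_le: "(norm (a i j))\<^sup>2 \<le> (d i j)\<^sup>2" if "i < n" "j < n" for i j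
    using lip[OF that] by (auto simp: a_def norm_minus_commute intro!: power_mono)
  have second: "(\<Sum>j<n. P i j * (norm (a i j))\<^sup>2) \<le> v i" if "i < n" for i
    unfolding v_def using a_le that C(3) by (intro sum_mono mult_left_mono) auto
  have mean: "(\<Sum>j<n. P i j *\<^sub>R \<xi> i j) = 0" if "i < n" for i
    using C(4)[OF that] by (simp add: \<xi>_def scaleR_diff_right sum_subtractf scaleR_left.sum[symmetric] m_def[symmetric])
  have var: "(\<Sum>j<n. P i j * (norm (\<xi> i j))\<^sup>2) \<le> v i" if "i < n" for i
    using centered_second_moment[OF C(4)[OF that], of "a i"] second[OF that] by (simp add: \<xi>_def m_def)
  have m_le: "(norm (m i))\<^sup>2 \<le> v i" if "i < n" for i
    using norm_sum_square_le[of "{..<n}" "P i" "a i"] C(3,4) that second[OF that] by (simp add: m_def)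
  have V0: "0 \<le> V l" and V_le: "\<And>i. i \<in> set l \<Longrightarrow> v i \<le> V l" if "set l \<subseteq> {..<n}" for l
  proof -
    have nn: "0 \<le> y" if "y \<in> set (map v l)" for y using v0 \<open>set l \<subseteq> {..<n}\<close> that by force
    then show "0 \<le> V l" unfolding V_def by (rule sum_list_nonneg)
    show "v i \<le> V l" if "i \<in> set l" for i unfolding V_def using nn that by (intro member_le_sum_list) auto
  qed
  have Vrev: "V (rev l) = V l" for l by (simp add: V_def rev_map[symmetric])
  have D0: "0 \<le> D l" for l unfolding D_def by (rule step_sum_nonneg) simp
  have g0: "0 \<le> scale_profile s b" for b by (simp add: scale_profile_def)

  \<comment> \<open>A displacement of at least \<open>s\<close> has one of three causes: a long
    step, so that \<open>D\<close> reaches \<open>s^2\<close>; a large variation, so that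
    \<open>V^2\<close> reaches \<open>s^4 / 16\<close>; or one of the two martingales reaching
    \<open>s / 2\<close>, whose fourth power is \<open>s^4 / 16\<close>.\<close>
  have pathwise: "(if s \<le> norm (u (last l) - u (hd l)) then s\<^sup>2 else 0) \<le>
      D l + 16 * scale_profile s (V l) + 16 / s\<^sup>2 * ((norm (x l))^4 + (norm (x (rev l)))^4)"
    if l: "l \<in> paths n t" for l
  proof (cases "s \<le> norm (u (last l) - u (hd l)) \<and> D l < s\<^sup>2 \<and> V l < \<theta>")
    case False
    define R where "R = 16 / s\<^sup>2 * ((norm (x l))^4 + (norm (x (rev l)))^4)"
    have "0 \<le> R" by (simp add: R_def)
    moreover have "s\<^sup>2 \<le> 16 * scale_profile s (V l)" if "\<theta> \<le> V l"
    proof -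
      have "s\<^sup>2 * s\<^sup>2 / 16 = \<theta>\<^sup>2" by (simp add: \<theta>_def power2_eq_square)
      also have "\<dots> \<le> (V l)\<^sup>2" using that by (intro power_mono) (auto simp: \<theta>_def)
      finally have "s\<^sup>2 / 16 \<le> (V l)\<^sup>2 / s\<^sup>2" using s by (simp add: le_divide_eq)
      then show ?thesis by (simp add: scale_profile_def min_def mult.commute)
    qed
    ultimately show ?thesis unfolding R_def[symmetric]
      using False D0[of l] g0[of "V l"] by (auto simp: not_less)
  next
    case True
    have ne: "l \<noteq> []" and sl: "set l \<subseteq> {..<n}" using l by (auto simp: paths_def)
    define b where "b = hd l"
    define e where "e = last l"
    have "b < n" "e < n" "b \<in> set l" "e \<in> set l" using paths_hd_last[OF l] ne by (auto simp: b_def e_def)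
    have H: "x l = step_sum \<xi> l" "x (rev l) = step_sum \<xi> (rev l)"
      unfolding x_def using True sl v0 Vrev[of l]
      by (auto intro!: stopped_sum_eq_step_sum simp: V_def)
    have A: "step_sum a l = u b - u e"
      unfolding a_def b_def e_def using True s ne by (intro step_sum_potential[where c = "s\<^sup>2"]) (auto simp: D_def)
    \<comment> \<open>The drift is subtracted at every state but the newest, hence the correction
      \<open>m (hd l')\<close>. The full sums of \<open>m\<close> agree for a path and its reversal,
      so only the endpoint terms survive in the difference.\<close>
    have expand: "step_sum \<xi> l' = step_sum a l' - sum_list (map m l') + m (hd l')" if "l' \<noteq> []" for l'
      using that by (induction l' rule: induct_list012) (auto simp: \<xi>_def)
    have "step_sum a (rev l) = step_sum (\<lambda>i j. - a i j) l"
      unfolding step_sum_rev using sym by (intro arg_cong2[where f = step_sum]) (auto simp: a_def fun_eq_iff)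
    also have "\<dots> = - step_sum a l" by (induction l rule: induct_list012) auto
    finally have "x l - x (rev l) = 2 *\<^sub>R (u b - u e) + m b - m e"
      unfolding H using expand[OF ne] expand[of "rev l"] ne A
      by (simp add: hd_rev b_def e_def rev_map[symmetric] scaleR_2)
    then have "2 *\<^sub>R (u b - u e) = (x l - x (rev l)) + (m e - m b)" by simp
    then have "norm (2 *\<^sub>R (u b - u e)) \<le> norm (x l - x (rev l)) + norm (m e - m b)"
      by (metis norm_triangle_ineq)
    also have "\<dots> \<le> (norm (x l) + norm (x (rev l))) + (norm (m e) + norm (m b))"
      by (intro add_mono norm_triangle_ineq4)
    finally have "2 * norm (u b - u e) \<le> norm (x l) + norm (x (rev l)) + norm (m e) + norm (m b)" by simp
    moreover have mle: "norm (m i) \<le> s / 2" if "i \<in> set l" for i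
    proof -
      have "(norm (m i))\<^sup>2 \<le> (s / 2)\<^sup>2"
        using m_le[of i] V_le[OF sl that] True sl that by (auto simp: \<theta>_def power_divide)
      then show ?thesis using s by (auto intro: power2_le_imp_le)
    qed
    moreover have "s \<le> norm (u b - u e)" using True by (simp add: b_def e_def norm_minus_commute)
    ultimately have "s \<le> norm (x l) + norm (x (rev l))"
      using mle[OF \<open>b \<in> set l\<close>] mle[OF \<open>e \<in> set l\<close>] by linarith
    then have "s / 2 \<le> norm (x l) \<or> s / 2 \<le> norm (x (rev l))" by linarith
    then have "(s / 2)^4 \<le> (norm (x l))^4 \<or> (s / 2)^4 \<le> (norm (x (rev l)))^4"
      using s power_mono[of "s / 2" _ 4] by auto
    then have "(s / 2)^4 \<le> (norm (x l))^4 + (norm (x (rev l)))^4"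
      using zero_le_power[OF norm_ge_zero, of "x l" 4] zero_le_power[OF norm_ge_zero, of "x (rev l)" 4] by linarith
    then have "16 / s\<^sup>2 * (s / 2)^4 \<le> 16 / s\<^sup>2 * ((norm (x l))^4 + (norm (x (rev l)))^4)"
      by (intro mult_left_mono) auto
    moreover have "16 / s\<^sup>2 * (s / 2)^4 = s\<^sup>2" using s by (simp add: power4_eq_xxxx power2_eq_square)
    ultimately show ?thesis using D0[of l] g0[of "V l"] by (auto simp del: power_divide)
  qed

  define G where "G = real t * (\<Sum>i<n. \<Sum>j<n. w i * P i j * scale_profile s ((d i j)\<^sup>2))"
  define EV where "EV = path_expectation n w P t (\<lambda>l. scale_profile s (V l))"
  have ED: "path_expectation n w P t D \<le> G"
  proof -
    have "(if s < d i j then s\<^sup>2 else 0) \<le> scale_profile s ((d i j)\<^sup>2)" for i j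
    proof (cases "s < d i j")
      case True
      then have "s\<^sup>2 \<le> (d i j)\<^sup>2" using s by (intro power_mono) auto
      then have "s\<^sup>2 * s\<^sup>2 \<le> (d i j)\<^sup>2 * (d i j)\<^sup>2" by (intro mult_mono) auto
      then show ?thesis using True s by (simp add: scale_profile_def le_divide_eq power2_eq_square)
    qed (use g0 in simp)
    then show ?thesis unfolding D_def path_expectation_step_sum[OF chain] G_def
      using C(1,3) by (intro mult_left_mono sum_mono) auto
  qed
  have Ex: "path_expectation n w P t (\<lambda>l. (norm (x l))^4) \<le> 64 * (s\<^sup>2 * EV) + 96 * (s\<^sup>2 * G)"
  proof -
    have "path_expectation n w P t (\<lambda>l. (norm (x l))^4)
     \<le> 64 * path_expectation n w P t (\<lambda>l. (S l)\<^sup>2)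
       + 6 * (real t * (\<Sum>i<n. \<Sum>j<n. w i * P i j * (norm (\<xi> i j))^4))"
      unfolding x_def S_def by (rule stopped_martingale_fourth_moment[OF chain mean var])
    \<comment> \<open>Stopping caps \<open>S l\<close> at \<open>\<theta>\<close>, so
      \<open>(S l)^2\<close> is at most both \<open>s^4\<close> and \<open>(V l)^2\<close>.\<close>
    moreover have "path_expectation n w P t (\<lambda>l. (S l)\<^sup>2) \<le> path_expectation n w P t (\<lambda>l. s\<^sup>2 * scale_profile s (V l))"
    proof (rule path_expectation_mono[OF chain])
      fix l assume l: "l \<in> paths n t"
      have sl: "set l \<subseteq> {..<n}" "l \<noteq> []" using l by (auto simp: paths_def)
      have "0 \<le> S l \<and> S l \<le> V (tl l) \<and> S l \<le> \<theta>"
        unfolding S_def V_def using sl v0 by (intro stopped_sum_bounds) (auto simp: \<theta>_def)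
      moreover have "V (tl l) \<le> V l" using sl v0 by (cases l) (auto simp: V_def)
      ultimately have Sl: "0 \<le> S l" "S l \<le> V l" "S l \<le> \<theta>" by auto
      have "(S l)\<^sup>2 \<le> (V l)\<^sup>2" using Sl by (intro power_mono) auto
      moreover have "(S l)\<^sup>2 \<le> (s\<^sup>2)\<^sup>2" using Sl zero_le_power2[of s] unfolding \<theta>_def by (intro power_mono) linarith+
      ultimately show "(S l)\<^sup>2 \<le> s\<^sup>2 * scale_profile s (V l)"
        using s by (auto simp: scale_profile_def min_def power2_eq_square)
    qed
    moreover have "\<dots> = s\<^sup>2 * EV" unfolding EV_def by (rule path_expectation_cmult[OF chain])
    moreover have "real t * (\<Sum>i<n. \<Sum>j<n. w i * P i j * (norm (\<xi> i j))^4) \<le> 16 * (s\<^sup>2 * G)"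
    proof -
      have "(\<Sum>j<n. P i j * (norm (\<xi> i j))^4) \<le> 16 * (s\<^sup>2 * (\<Sum>j<n. P i j * scale_profile s ((d i j)\<^sup>2)))" if i: "i < n" for i
      proof -
        have "(\<Sum>j<n. P i j * (norm (\<xi> i j))^4) \<le> 16 * (\<Sum>j<n. P i j * (norm (a i j))^4)"
          unfolding \<xi>_def m_def using C(3,4) i by (intro centered_fourth_moment) auto
        \<comment> \<open>A truncated increment has norm at most both \<open>s\<close> and
          \<open>d i j\<close>, and the fourth powers of these two bounds are the two branches of
          the profile times \<open>s^2\<close>.\<close>
        also have "(\<Sum>j<n. P i j * (norm (a i j))^4) \<le> (\<Sum>j<n. P i j * (s\<^sup>2 * scale_profile s ((d i j)\<^sup>2)))"
        proof (intro sum_mono mult_left_mono)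
          fix j assume j: "j \<in> {..<n}"
          show "(norm (a i j))^4 \<le> s\<^sup>2 * scale_profile s ((d i j)\<^sup>2)"
          proof (cases "s < d i j")
            case False
            have d0: "0 \<le> d i j" using order_trans[OF norm_ge_zero lip[of i j]] i j by simp
            have "((norm (a i j))\<^sup>2)\<^sup>2 \<le> ((d i j)\<^sup>2)\<^sup>2" using i j by (intro power_mono[OF a_le zero_le_power2]) auto
            moreover have "(d i j)\<^sup>2 \<le> s\<^sup>2" using False d0 by (intro power_mono) auto
            then have "((d i j)\<^sup>2)\<^sup>2 \<le> (s\<^sup>2)\<^sup>2" by (rule power_mono) simp
            ultimately show ?thesis
              using s by (auto simp: scale_profile_def min_def power2_eq_square power4_eq_xxxx mult.assoc)
          qed (use g0 in \<open>simp add: a_def\<close>)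
          show "0 \<le> P i j" using C(3) i j by simp
        qed
        also have "\<dots> = s\<^sup>2 * (\<Sum>j<n. P i j * scale_profile s ((d i j)\<^sup>2))" by (simp add: sum_distrib_left mult_ac)
        finally show ?thesis by simp
      qed
      then have "(\<Sum>i<n. w i * (\<Sum>j<n. P i j * (norm (\<xi> i j))^4)) \<le>
          (\<Sum>i<n. w i * (16 * (s\<^sup>2 * (\<Sum>j<n. P i j * scale_profile s ((d i j)\<^sup>2)))))"
        using C(1) by (intro sum_mono mult_left_mono) auto
      then have "real t * (\<Sum>i<n. w i * (\<Sum>j<n. P i j * (norm (\<xi> i j))^4)) \<le>
          real t * (\<Sum>i<n. w i * (16 * (s\<^sup>2 * (\<Sum>j<n. P i j * scale_profile s ((d i j)\<^sup>2)))))"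
        by (intro mult_left_mono) auto
      then show ?thesis by (simp add: G_def sum_distrib_left mult_ac)
    qed
    ultimately show ?thesis by linarith
  qed
  have "(\<Sum>i<n. \<Sum>j<n. w i * mat_pow n P t i j * (if s \<le> norm (u i - u j) then s\<^sup>2 else 0))
      = path_expectation n w P t (\<lambda>l. if s \<le> norm (u (last l) - u (hd l)) then s\<^sup>2 else 0)"
    using path_expectation_endpoints[OF chain, of t "\<lambda>i j. if s \<le> norm (u i - u j) then s\<^sup>2 else 0"] by simp
  also have "\<dots> \<le> path_expectation n w P t (\<lambda>l. D l + 16 * scale_profile s (V l)
      + 16 / s\<^sup>2 * ((norm (x l))^4 + (norm (x (rev l)))^4))"
    by (intro path_expectation_mono[OF chain] pathwise)
  also have "\<dots> = path_expectation n w P t D + 16 * EV + 16 / s\<^sup>2 * (path_expectation n w P t (\<lambda>l. (norm (x l))^4)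
      + path_expectation n w P t (\<lambda>l. (norm (x (rev l)))^4))"
    unfolding path_expectation_add[OF chain] path_expectation_cmult[OF chain] EV_def ..
  also have "path_expectation n w P t (\<lambda>l. (norm (x (rev l)))^4) = path_expectation n w P t (\<lambda>l. (norm (x l))^4)"
    by (rule path_expectation_rev[OF chain])
  also have "path_expectation n w P t D + 16 * EV + 16 / s\<^sup>2 * (path_expectation n w P t (\<lambda>l. (norm (x l))^4)
      + path_expectation n w P t (\<lambda>l. (norm (x l))^4))
     \<le> G + 16 * EV + 16 / s\<^sup>2 * (2 * (64 * (s\<^sup>2 * EV) + 96 * (s\<^sup>2 * G)))"
    using ED Ex by (intro add_mono mult_left_mono) auto
  \<comment> \<open>\<open>3073 = 1 + 16 * 2 * 96\<close> and
    \<open>2064 = 16 + 16 * 2 * 64\<close>; the 2 counts the path and its reversal.\<close>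
  also have "\<dots> = 3073 * G + 2064 * EV" using s by (simp add: field_simps)
  finally show ?thesis unfolding G_def EV_def V_def .
qed

section \<open>Summation over the dyadic scales\<close>

text \<open>The largest dyadic scale not exceeding \<open>z\<close> already accounts for a quarter
  of \<open>z^2\<close>.\<close>

lemma square_le_dyadic_sum:
  fixes z :: real
  assumes "0 < r" "z = 0 \<or> (r \<le> z \<and> z < r * 2 ^ N)"
  shows "z\<^sup>2 \<le> 4 * (\<Sum>k<N. if r * 2 ^ k \<le> z then (r * 2 ^ k)\<^sup>2 else 0)"
  using assms(2)
proof
  assume "z = 0"
  then show ?thesis using assms(1) by (auto intro!: sum_nonneg)
next
  assume z: "r \<le> z \<and> z < r * 2 ^ N"
  have "\<exists>k<N. r * 2 ^ k \<le> z \<and> z < r * 2 ^ Suc k"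
    using z
  proof (induction N)
    case (Suc N)
    then show ?case by (cases "z < r * 2 ^ N") (auto simp: less_Suc_eq not_less)
  qed auto
  then obtain k where k: "k < N" "r * 2 ^ k \<le> z" "z < r * 2 ^ Suc k" by blast
  have "z\<^sup>2 \<le> (2 * (r * 2 ^ k))\<^sup>2" using k z assms(1) by (intro power_mono) auto
  also have "\<dots> = 4 * (if r * 2 ^ k \<le> z then (r * 2 ^ k)\<^sup>2 else 0)" using k by (simp add: power_mult_distrib)
  also have "\<dots> \<le> 4 * (\<Sum>k<N. if r * 2 ^ k \<le> z then (r * 2 ^ k)\<^sup>2 else 0)"
    using k(1) by (intro mult_left_mono member_le_sum) auto
  finally show ?thesis .
qed

lemma dyadic_range:
  fixes d :: "nat \<Rightarrow> nat \<Rightarrow> real"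
  assumes "\<And>i j. 0 \<le> d i j"
  shows "\<exists>r>0. \<exists>N. \<forall>i<n. \<forall>j<n. d i j = 0 \<or> (r \<le> d i j \<and> d i j < r * 2 ^ N)"
proof -
  \<comment> \<open>Inserting 1 keeps the set nonempty when all distances vanish, so that
    \<open>Min\<close> and \<open>Max\<close> are meaningful.\<close>
  define A where "A = insert 1 ((\<lambda>(i, j). d i j) ` ({..<n} \<times> {..<n}) - {0})"
  have A: "finite A" "A \<noteq> {}" "\<And>z. z \<in> A \<Longrightarrow> 0 < z" using assms by (auto simp: A_def less_le)
  define r where "r = Min A"
  have r: "0 < r" using A Min_in unfolding r_def by blast
  obtain N :: nat where N: "Max A / r < 2 ^ N" using real_arch_pow[of 2 "Max A / r"] by auto
  have "r \<le> z \<and> z < r * 2 ^ N" if "z \<in> A" for z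
    using Min_le[OF A(1) that] Max_ge[OF A(1) that] N r by (auto simp: r_def[symmetric] divide_less_eq mult.commute)
  then have "d i j = 0 \<or> (r \<le> d i j \<and> d i j < r * 2 ^ N)" if "i < n" "j < n" for i j
    using that by (auto simp: A_def)
  then show ?thesis using r by blast
qed

lemma markov_type_of_threshold_embeds:
  fixes X :: "'a::metric_space set"
  assumes "threshold_embeds_l2 X"
  shows "markov_type 2 X"
proof -
  obtain K \<phi> where K: "0 < K" and \<phi>: "\<And>\<tau> x. 0 < \<tau> \<Longrightarrow> x \<in> X \<Longrightarrow> (\<phi> \<tau> x :: 'a \<Rightarrow> real) \<in> l2_space"
    "\<And>\<tau> x y. 0 < \<tau> \<Longrightarrow> x \<in> X \<Longrightarrow> y \<in> X \<Longrightarrow> l2_dist (\<phi> \<tau> x) (\<phi> \<tau> y) \<le> dist x y"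
    "\<And>\<tau> x y. 0 < \<tau> \<Longrightarrow> x \<in> X \<Longrightarrow> y \<in> X \<Longrightarrow> \<tau> \<le> dist x y \<Longrightarrow> \<tau> / K \<le> l2_dist (\<phi> \<tau> x) (\<phi> \<tau> y)"
    using assms unfolding threshold_embeds_l2_def by metis
  have "(\<Sum>i<n. \<Sum>j<n. w i * mat_pow n P t i j * (dist (f i) (f j))\<^sup>2)
         \<le> (340 * K)\<^sup>2 * real t * (\<Sum>i<n. \<Sum>j<n. w i * P i j * (dist (f i) (f j))\<^sup>2)"
    if chain: "rev_markov_chain n w P" and fX: "\<forall>i<n. f i \<in> X" for n w P and f :: "nat \<Rightarrow> 'a" and t
  proof (cases "t = 0")
    case True
    then show ?thesis by (auto intro!: sum_nonpos)
  next
    case False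
    note C = rev_markov_chainD[OF chain]
    define d where "d i j = dist (f i) (f j)" for i j
    define v where "v i = (\<Sum>j<n. P i j * (d i j)\<^sup>2)" for i
    define E where "E = (\<Sum>i<n. \<Sum>j<n. w i * P i j * (d i j)\<^sup>2)"
    have v0: "0 \<le> v i" if "i < n" for i unfolding v_def using C(3)[OF that] by (intro sum_nonneg) auto
    have E0: "0 \<le> E" unfolding E_def using C(1,3) by (intro sum_nonneg) auto
    obtain r N where r: "0 < r" and N: "\<And>i j. i < n \<Longrightarrow> j < n \<Longrightarrow> d i j = 0 \<or> (r \<le> d i j \<and> d i j < r * 2 ^ N)"
      using dyadic_range[of d n] by (auto simp: d_def)
    \<comment> \<open>The map of threshold \<open>r * 2 ^ k\<close> separates only to
      \<open>\<sigma> k\<close>, smaller by the factor \<open>K\<close>. These image scales are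
      again dyadic, so \<open>scale_profile_sum\<close> applies to them.\<close>
    define \<sigma> where "\<sigma> k = r / K * 2 ^ k" for k :: nat
    have \<sigma>: "0 < \<sigma> k" "r * 2 ^ k = K * \<sigma> k" for k using r K by (auto simp: \<sigma>_def)
    define u where "u k i = ell2_of (\<phi> (r * 2 ^ k) (f i))" for k i
    have un: "norm (u k i - u k j) = l2_dist (\<phi> (r * 2 ^ k) (f i)) (\<phi> (r * 2 ^ k) (f j))" if "i < n" "j < n" for k i j
      unfolding u_def using r fX that by (intro norm_ell2_of_diff \<phi>) auto
    have up: "norm (u k i - u k j) \<le> d i j" if "i < n" "j < n" for k i j
      unfolding un[OF that] d_def using r fX that by (intro \<phi>) auto
    have low: "\<sigma> k \<le> norm (u k i - u k j)" if "i < n" "j < n" "r * 2 ^ k \<le> d i j" for k i j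
      using \<phi>(3)[of "r * 2 ^ k" "f i" "f j"] r fX that un[OF that(1,2)] by (simp add: \<sigma>_def d_def)
    have pt: "(d i j)\<^sup>2 \<le> 4 * K\<^sup>2 * (\<Sum>k<N. if \<sigma> k \<le> norm (u k i - u k j) then (\<sigma> k)\<^sup>2 else 0)" if ij: "i < n" "j < n" for i j
    proof -
      have "(d i j)\<^sup>2 \<le> 4 * (\<Sum>k<N. if r * 2 ^ k \<le> d i j then (r * 2 ^ k)\<^sup>2 else 0)"
        by (rule square_le_dyadic_sum[OF r N[OF ij]])
      also have "(\<Sum>k<N. if r * 2 ^ k \<le> d i j then (r * 2 ^ k)\<^sup>2 else 0)
         \<le> (\<Sum>k<N. K\<^sup>2 * (if \<sigma> k \<le> norm (u k i - u k j) then (\<sigma> k)\<^sup>2 else 0))"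
        using low[OF ij] by (intro sum_mono) (auto simp: \<sigma>(2) power_mult_distrib)
      finally show ?thesis by (simp add: sum_distrib_left[symmetric] mult.assoc)
    qed
    have Q: "0 \<le> w i * mat_pow n P t i j" if "i < n" "j < n" for i j
      using C(1) mat_pow_nonneg[OF chain] that by simp
    have "(\<Sum>i<n. \<Sum>j<n. w i * mat_pow n P t i j * (d i j)\<^sup>2) \<le>
        (\<Sum>i<n. \<Sum>j<n. w i * mat_pow n P t i j * (4 * K\<^sup>2 * (\<Sum>k<N. if \<sigma> k \<le> norm (u k i - u k j) then (\<sigma> k)\<^sup>2 else 0)))"
      using pt Q by (intro sum_mono mult_left_mono) auto
    also have "\<dots> = 4 * K\<^sup>2 * (\<Sum>k<N. \<Sum>i<n. \<Sum>j<n. w i * mat_pow n P t i j * (if \<sigma> k \<le> norm (u k i - u k j) then (\<sigma> k)\<^sup>2 else 0))"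
    proof -
      have "(\<Sum>i<n. \<Sum>j<n. w i * mat_pow n P t i j * (4 * K\<^sup>2 * (\<Sum>k<N. h k i j))) =
          4 * K\<^sup>2 * (\<Sum>k<N. \<Sum>i<n. \<Sum>j<n. w i * mat_pow n P t i j * h k i j)" for h :: "nat \<Rightarrow> nat \<Rightarrow> nat \<Rightarrow> real"
      proof -
        have "(\<Sum>k<N. \<Sum>i<n. \<Sum>j<n. w i * mat_pow n P t i j * h k i j) = (\<Sum>i<n. \<Sum>j<n. \<Sum>k<N. w i * mat_pow n P t i j * h k i j)"
          by (subst sum.swap, rule sum.cong[OF refl], rule sum.swap)
        then show ?thesis by (simp add: sum_distrib_left mult_ac)
      qed
      then show ?thesis .
    qed
    also have "\<dots> \<le> 4 * K\<^sup>2 * (\<Sum>k<N. 3073 * (real t * (\<Sum>i<n. \<Sum>j<n. w i * P i j * scale_profile (\<sigma> k) ((d i j)\<^sup>2)))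
        + 2064 * path_expectation n w P t (\<lambda>l. scale_profile (\<sigma> k) (sum_list (map v l))))"
      unfolding v_def using up \<sigma>(1)
      by (intro mult_left_mono sum_mono single_scale_bound[OF chain]) (auto simp: d_def dist_commute)
    also have "\<dots> = 4 * K\<^sup>2 * (3073 * (real t * (\<Sum>i<n. \<Sum>j<n. w i * P i j * (\<Sum>k<N. scale_profile (\<sigma> k) ((d i j)\<^sup>2))))
        + 2064 * path_expectation n w P t (\<lambda>l. \<Sum>k<N. scale_profile (\<sigma> k) (sum_list (map v l))))"
    proof -
      have "(\<Sum>i<n. \<Sum>j<n. w i * P i j * (\<Sum>k<N. h k i j)) = (\<Sum>k<N. \<Sum>i<n. \<Sum>j<n. w i * P i j * h k i j)" for h :: "nat \<Rightarrow> nat \<Rightarrow> nat \<Rightarrow> real"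
        unfolding sum_distrib_left by (subst (2) sum.swap, rule sum.cong[OF refl], rule sum.swap)
      then show ?thesis
        unfolding path_expectation_sum[OF chain] sum.distrib sum_distrib_left[symmetric] by simp
    qed
    also have "\<dots> \<le> 4 * K\<^sup>2 * (3073 * (real t * (\<Sum>i<n. \<Sum>j<n. w i * P i j * (4 * (d i j)\<^sup>2)))
        + 2064 * path_expectation n w P t (\<lambda>l. 4 * sum_list (map v l)))"
    proof -
      have rK: "0 < r / K" using r K by simp
      have "path_expectation n w P t (\<lambda>l. \<Sum>k<N. scale_profile (\<sigma> k) (sum_list (map v l))) \<le> path_expectation n w P t (\<lambda>l. 4 * sum_list (map v l))"
        unfolding \<sigma>_def using v0
        by (intro path_expectation_mono[OF chain] scale_profile_sum rK sum_list_nonneg) (auto simp: paths_def)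
      moreover have "(\<Sum>i<n. \<Sum>j<n. w i * P i j * (\<Sum>k<N. scale_profile (\<sigma> k) ((d i j)\<^sup>2))) \<le> (\<Sum>i<n. \<Sum>j<n. w i * P i j * (4 * (d i j)\<^sup>2))"
        unfolding \<sigma>_def using C(1,3) by (intro sum_mono mult_left_mono scale_profile_sum rK) auto
      ultimately show ?thesis by (intro mult_left_mono add_mono) auto
    qed
    also have "(\<Sum>i<n. \<Sum>j<n. w i * P i j * (4 * (d i j)\<^sup>2)) = 4 * E" by (simp add: E_def sum_distrib_left mult_ac)
    also have "path_expectation n w P t (\<lambda>l. 4 * sum_list (map v l)) = 4 * (real (Suc t) * E)"
      unfolding path_expectation_cmult[OF chain] path_expectation_sum_list[OF chain]
      by (simp add: E_def v_def sum_distrib_left mult.assoc)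
    \<comment> \<open>\<open>V\<close> runs over \<open>t + 1\<close> states while the energy counts
      \<open>t\<close> steps, hence the factor 2 and the separate case \<open>t = 0\<close>. The
      resulting constant \<open>4 * 28804\<close> is rounded up to
      \<open>4 * 170^2 = 340^2\<close>.\<close>
    also have "4 * K\<^sup>2 * (3073 * (real t * (4 * E)) + 2064 * (4 * (real (Suc t) * E))) \<le> (340 * K)\<^sup>2 * real t * E"
    proof -
      have "real (Suc t) * E \<le> 2 * real t * E" using False E0 by (intro mult_right_mono) auto
      then have "3073 * (real t * (4 * E)) + 2064 * (4 * (real (Suc t) * E)) \<le> 28804 * (real t * E)" by linarith
      also have "\<dots> \<le> 28900 * (real t * E)" using E0 by (intro mult_right_mono) auto
      finally have "4 * K\<^sup>2 * (3073 * (real t * (4 * E)) + 2064 * (4 * (real (Suc t) * E))) \<le> 4 * K\<^sup>2 * (28900 * (real t * E))"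
        by (intro mult_left_mono) auto
      then show ?thesis by (simp add: power_mult_distrib)
    qed
    finally show ?thesis unfolding E_def d_def .
  qed
  then have "markov_bound (340 * K) X" unfolding markov_bound_def by blast
  then show ?thesis unfolding markov_type_2_iff using K by (intro exI[of _ "340 * K"]) simp
qed

theorem theorem5p3:
  fixes X :: "'z::banach set"
  assumes "(\<exists>f :: 'z \<Rightarrow> 'h::{real_inner, complete_space}. coarse_embedding f)
         \<or> (\<exists>f :: 'z \<Rightarrow> 'h. uniform_embedding f)"
  shows "markov_type 2 X \<longleftrightarrow> threshold_embeds_l2 X"
proof
  assume "markov_type 2 X"
  then show "threshold_embeds_l2 X" using assms threshold_embeds_of_markov_type by blast
next
  assume "threshold_embeds_l2 X"
  then show "markov_type 2 X" by (rule markov_type_of_threshold_embeds)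
qed

end
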